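(* Let $p$ be an odd prime and $x\in\mathbb Z_p$. Put $T(x)=\dfrac{B_{p^2(p-1)}(-x)-B_{p^2(p-1)}}{p^2(p-1)}$. Then $$V_{p-1}(x)\equiv1-2pT(x)+2p^2T(x)^2\pmod{p^3}.$$ Consequently, for $p>3$: $V_{p-1}^{(3)}\equiv729^{p-1}$, $V_{p-1}^{(4)}\equiv4096^{p-1}$ and $V_{p-1}^{(6)}\equiv186624^{p-1}\pmod{p^3}$.
   Context: For real $x$ and integer $k\ge0$, $\binom xk=x(x-1)\cdots(x-k+1)/k!$. $V_n(x)=\sum_{k=0}^n\binom nk\binom{n+k}k(-1)^k\binom xk\binom{-1-x}k$. $\mathbb Z_p$ is the set of rationals with denominator prime to $p$; congruences modulo powers of $p$ are in $\mathbb Z_p$. Bernoulli numbers: $B_0=1$, $\sum_{k=0}^{n-1}\binom nkB_k=0$ ($n\ge2$); $B_n(x)=\sum_{k=0}^n\binom nkB_kx^{n-k}$. $V_n^{(3)}=27^nV_n(-\tfrac13)$, $V_n^{(4)}=64^nV_n(-\tfrac14)$, $V_n^{(6)}=432^nV_n(-\tfrac16)$.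
   Formalization: The congruence for V_{p-1}(x) is false as stated for p=3 when x≡3,4,5 (mod 9) (e.g. x=3: 10 versus 19 mod 27); exactly these x are excluded for p=3, and everything else is as stated. *)

theory Defs
  imports Complex_Main "HOL-Number_Theory.Number_Theory"
begin

text \<open>
  Everything lives in \<^typ>\<open>rat\<close>: \<open>Zp p\<close> is the ring of rationals whose reduced denominator
  is prime to \<open>p\<close> (the localization of the integers at \<open>p\<close>), not the ring of \<open>p\<close>-adic integers.
\<close>

definition Zp :: "nat \<Rightarrow> rat set" where
  "Zp p = {x. coprime (snd (quotient_of x)) (int p)}"

definition cong_Zp :: "nat \<Rightarrow> nat \<Rightarrow> rat \<Rightarrow> rat \<Rightarrow> bool" where
  "cong_Zp p m a b \<longleftrightarrow> a \<in> Zp p \<and> b \<in> Zp p \<and> (\<exists>c\<in>Zp p. a - b = of_nat p ^ m * c)"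

text \<open>
  The defining equation is the recurrence \<open>\<Sum>k<n. (n choose k) B\<^sub>k = 0\<close> solved for its last
  term; the recurrence itself is \<open>bernoulli_recurrence\<close> below.
\<close>

fun bernoulli :: "nat \<Rightarrow> rat" where
  "bernoulli n = (if n = 0 then 1
     else - (\<Sum>k<n. of_nat (Suc n choose k) * bernoulli k) / of_nat (Suc n))"

declare bernoulli.simps [simp del]

lemma bernoulli_0: "bernoulli 0 = 1"
  by (simp add: bernoulli.simps)

lemma bernoulli_recurrence:
  assumes "n \<ge> 2"
  shows "(\<Sum>k<n. of_nat (n choose k) * bernoulli k) = 0"
proof -
  obtain m where m: "n = Suc m" "m > 0"
    using assms by (cases n) auto
  have "of_nat (Suc m) * bernoulli m = - (\<Sum>k<m. of_nat (Suc m choose k) * bernoulli k)"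
    using m by (subst bernoulli.simps) (simp del: of_nat_Suc binomial_Suc_Suc)
  then show ?thesis
    using m by (simp del: of_nat_Suc binomial_Suc_Suc)
qed

definition bernoulli_poly :: "nat \<Rightarrow> rat \<Rightarrow> rat" where
  "bernoulli_poly n x = (\<Sum>k\<le>n. of_nat (n choose k) * bernoulli k * x ^ (n - k))"

definition V :: "nat \<Rightarrow> rat \<Rightarrow> rat" where
  "V n x = (\<Sum>k\<le>n. of_nat (n choose k) * of_nat ((n + k) choose k) * (- 1) ^ k
              * (x gchoose k) * ((- 1 - x) gchoose k))"

definition V3 :: "nat \<Rightarrow> rat" where "V3 n = 27 ^ n * V n (- 1 / 3)"

definition V4 :: "nat \<Rightarrow> rat" where "V4 n = 64 ^ n * V n (- 1 / 4)"

definition V6 :: "nat \<Rightarrow> rat" where "V6 n = 432 ^ n * V n (- 1 / 6)"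

definition T :: "nat \<Rightarrow> rat \<Rightarrow> rat" where
  "T p x = (bernoulli_poly (p\<^sup>2 * (p - 1)) (- x) - bernoulli (p\<^sup>2 * (p - 1)))
             / of_nat (p\<^sup>2 * (p - 1))"

text \<open>
  The congruence for \<open>V (p - 1) x\<close> modulo \<open>p\<^sup>3\<close> fails at the prime 3 on exactly three residue
  classes modulo 9. There, for an integer \<open>x \<ge> 0\<close>, \<open>T 3 x = (\<Sum>i=1..x. i ^ 17)\<close>, so both
  \<open>T 3 x\<close> modulo 9 and \<open>V 2 x\<close> modulo 27 depend only on \<open>x\<close> modulo 9, and the two sides of the
  congruence differ for \<open>x = 3, 4, 5\<close> (see \<open>congruence_fails_at_3\<close>) but agree for
  \<open>x = 0, 1, 2, 6, 7, 8\<close>.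
\<close>

definition exceptional :: "nat \<Rightarrow> rat \<Rightarrow> bool" where
  "exceptional p x \<longleftrightarrow> p = 3 \<and> (cong_Zp 3 2 x 3 \<or> cong_Zp 3 2 x 4 \<or> cong_Zp 3 2 x 5)"

lemma bernoulli_recurrence_atMost:
  "(\<Sum>k\<le>n. of_nat (n choose k) * bernoulli k) = bernoulli n + (if n = 1 then 1 else 0)"
proof -
  consider "n = 0" | "n = 1" | "n \<ge> 2" by linarith
  then show ?thesis
  proof cases
    case 3
    then show ?thesis
      using bernoulli_recurrence[OF 3] by (simp add: lessThan_Suc_atMost[symmetric])
  qed (simp_all add: bernoulli_0)
qed

lemma bernoulli_poly_diff:
  "bernoulli_poly n (y + 1) = bernoulli_poly n y + of_nat n * y ^ (n - 1)"
proof -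
  have reflect: "bernoulli_poly n y = (\<Sum>j\<le>n. of_nat (n choose j) * y ^ j * bernoulli (n - j))"
    unfolding bernoulli_poly_def
    by (rule sum.reindex_bij_witness[of _ "\<lambda>j. n - j" "\<lambda>k. n - k"])
       (auto simp: binomial_symmetric[symmetric])
  have "bernoulli_poly n (y + 1)
      = (\<Sum>k\<le>n. \<Sum>j\<le>n - k. of_nat (n choose k) * bernoulli k * (of_nat ((n - k) choose j) * y ^ j))"
    unfolding bernoulli_poly_def by (simp add: binomial_ring sum_distrib_left)
  also have "\<dots> = (\<Sum>j\<le>n. \<Sum>k\<le>n - j.
      of_nat (n choose k) * bernoulli k * (of_nat ((n - k) choose j) * y ^ j))"
    unfolding sum.Sigma[OF finite_atMost ballI[OF finite_atMost]]
    by (rule sum.reindex_bij_witness[of _ "\<lambda>(a, b). (b, a)" "\<lambda>(a, b). (b, a)"]) auto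
  also have "\<dots> = (\<Sum>j\<le>n. of_nat (n choose j) * y ^ j *
      (\<Sum>k\<le>n - j. of_nat ((n - j) choose k) * bernoulli k))"
    unfolding sum_distrib_left
  proof (intro sum.cong refl)
    fix j k assume "j \<in> {..n}" "k \<in> {..n - j}"
    then have "j + k \<le> n" by auto
    then have "(n choose k) * ((n - k) choose j) = (n choose j) * ((n - j) choose k)"
      using choose_mult[of k "j + k" n] choose_mult[of j "j + k" n]
      by (simp add: binomial_symmetric[of j "j + k"])
    then have "of_nat (n choose k) * of_nat ((n - k) choose j)
      = (of_nat (n choose j) * of_nat ((n - j) choose k) :: rat)"
      by (metis of_nat_mult)
    then show "of_nat (n choose k) * bernoulli k * (of_nat ((n - k) choose j) * y ^ j)
      = of_nat (n choose j) * y ^ j * (of_nat ((n - j) choose k) * bernoulli k)"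
      by (simp add: algebra_simps)
  qed
  also have "\<dots> = bernoulli_poly n y
      + (\<Sum>j\<le>n. if n - j = 1 then of_nat (n choose j) * y ^ j else 0)"
    unfolding bernoulli_recurrence_atMost reflect sum.distrib[symmetric]
    by (intro sum.cong) (auto simp: algebra_simps)
  also have "(\<Sum>j\<le>n. if n - j = 1 then of_nat (n choose j) * y ^ j else 0) = of_nat n * y ^ (n - 1)"
  proof (cases n)
    case (Suc m)
    have "(\<Sum>j\<le>n. if n - j = 1 then of_nat (n choose j) * y ^ j else 0)
        = (\<Sum>j\<le>n. if j = m then of_nat (n choose j) * y ^ j else 0)"
      by (intro sum.cong) (auto simp: Suc)
    then show ?thesis by (simp add: Suc del: of_nat_Suc)
  qed simp
  finally show ?thesis .
qed

lemma T_3: "T 3 3 = 129271236" "T 3 4 = 17309140420" "T 3 5 = 780248593545"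
proof -
  have 0: "bernoulli_poly 18 0 = bernoulli 18"
  proof -
    have "bernoulli_poly 18 0 = (\<Sum>k\<le>18. if k = 18 then bernoulli k else 0)"
      unfolding bernoulli_poly_def by (intro sum.cong) auto
    then show ?thesis by simp
  qed
  have d: "bernoulli_poly 18 y = bernoulli_poly 18 (y + 1) - 18 * y ^ 17" for y
    using bernoulli_poly_diff[of 18 y] by simp
  have 1: "bernoulli_poly 18 (- 1) = bernoulli 18 + 18"
    using d[of "- 1"] 0 by simp
  have 2: "bernoulli_poly 18 (- 2) = bernoulli 18 + 18 * 131073"
    using d[of "- 2"] 1 by simp
  have 3: "bernoulli_poly 18 (- 3) = bernoulli 18 + 18 * 129271236"
    using d[of "- 3"] 2 by simp
  have 4: "bernoulli_poly 18 (- 4) = bernoulli 18 + 18 * 17309140420"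
    using d[of "- 4"] 3 by simp
  have 5: "bernoulli_poly 18 (- 5) = bernoulli 18 + 18 * 780248593545"
    using d[of "- 5"] 4 by simp
  show "T 3 3 = 129271236" "T 3 4 = 17309140420" "T 3 5 = 780248593545"
    using 3 4 5 by (simp_all add: T_def)
qed

lemma V_2: "V 2 3 = 253" "V 2 4 = 1 + 6 * 20 + 6 * 6 * 15" "V 2 5 = 1 + 6 * 30 + 6 * 10 * 21"
  by code_simp+

lemma congruence_fails_at_3:
  assumes "x \<in> {3, 4, 5}"
  shows "x \<in> Zp 3" "\<not> cong_Zp 3 3 (V 2 x) (1 - 2 * 3 * T 3 x + 2 * 3\<^sup>2 * (T 3 x)\<^sup>2)"
proof -
  show "x \<in> Zp 3"
    using assms by (auto simp: Zp_def)
  have no: "\<not> cong_Zp 3 3 a b" if "(a - b) / 27 \<notin> Zp 3" for a b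
    using that by (auto simp: cong_Zp_def)
  show "\<not> cong_Zp 3 3 (V 2 x) (1 - 2 * 3 * T 3 x + 2 * 3\<^sup>2 * (T 3 x)\<^sup>2)"
    using assms by (intro no) (elim insertE emptyE; simp only: T_3 V_2 Zp_def mem_Collect_eq; code_simp)
qed

end

theory Submission
  imports Defs "HOL-Computational_Algebra.Formal_Power_Series"
begin

text \<open>
  Congruences are propagated along natural numbers, which approximate every \<open>x \<in> Zp p\<close>.
  Let \<open>harm m\<close> be the sum of \<open>1 / j\<close> over \<open>j \<le> m\<close> prime to \<open>p\<close>. For natural \<open>m\<close> the Bernoulli
  quotient is \<open>T p m = (\<Sum>j=1..m. j ^ (p\<^sup>2 * (p - 1) - 1))\<close>, which is \<open>harm m\<close> modulo \<open>p\<^sup>2\<close> by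
  Euler's theorem. On the other side, \<open>V (p - 1) x - V (p - 1) (x - 1)\<close> factors modulo \<open>p\<^sup>3\<close> as
  \<open>2 * p * x\<close> times a sum. For \<open>x = m\<close> prime to \<open>p\<close>, \<open>x\<^sup>2\<close> times this sum splits into a telescoping
  part, equal to \<open>-1\<close> plus a product divisible by \<open>p\<^sup>2\<close>, and \<open>p\<close> times a part that
  Vandermonde's identity evaluates to \<open>harm m + harm (m - 1)\<close> modulo \<open>p\<close>. If \<open>p\<close> divides \<open>x\<close>, the
  sum reduces to minus the sum of \<open>1 / j\<^sup>2\<close> over \<open>0 < j < p\<close>, which vanishes modulo \<open>p\<close> except for
  \<open>p = 3\<close>.

  For \<open>x = - 1 / d\<close> write \<open>N = p\<^sup>2\<close>. Dividing \<open>d * a\<close> by \<open>N\<close> with remainder, for all units \<open>a\<close>, and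
  multiplying gives Lerch's formula: \<open>d * (d ^ (p * (p - 1)) - 1)\<close> is
  \<open>- N * (\<Sum>i=1..<d. harm (i * N div d))\<close> modulo \<open>N\<^sup>2\<close>. With the reflection of \<open>harm (N - 1 - j)\<close>
  to \<open>harm j\<close> modulo \<open>N\<close>, the cases \<open>d = 2, 3, 4, 6\<close> show that \<open>A ^ (p * (p - 1))\<close> is
  \<open>1 - 2 * p\<^sup>2 * T p x\<close> modulo \<open>p\<^sup>4\<close> for \<open>A = 27, 64, 432\<close>; extracting the \<open>p\<close>-th root by the
  binomial theorem, \<open>A ^ (p - 1)\<close> is \<open>1 - 2 * p * T p x + 2 * p\<^sup>2 * (T p x)\<^sup>2\<close> modulo \<open>p\<^sup>3\<close>.
\<close>

subsection \<open>Backward differences of V\<close>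

text \<open>
  \<open>binprod k x\<close> is \<open>(x gchoose k) * ((x + k) gchoose k)\<close>; each denominator is attached to a factor so
  that the recursions in \<open>k\<close> are immediate.
\<close>

definition binprod :: "nat \<Rightarrow> rat \<Rightarrow> rat" where
  "binprod k x = (\<Prod>i<k. (x - of_nat i) * (x + 1 + of_nat i) / (of_nat (Suc i))\<^sup>2)"

text \<open>The even factor shared by neighbouring values: \<open>binprod (Suc k) x\<close> and
  \<open>binprod (Suc k) (x - 1)\<close> are \<open>x * (x + k + 1)\<close> and
  \<open>x * (x - k - 1)\<close> times it.\<close>

definition sqprod :: "nat \<Rightarrow> rat \<Rightarrow> rat" where
  "sqprod k x = (\<Prod>i<k. (x\<^sup>2 - (of_nat (Suc i))\<^sup>2) / (of_nat (Suc (Suc i)))\<^sup>2)"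

lemma binprod_0 [simp]: "binprod 0 x = 1" and sqprod_0 [simp]: "sqprod 0 x = 1"
  by (simp_all add: binprod_def sqprod_def)

lemma binprod_Suc:
  "binprod (Suc k) x = binprod k x * ((x - of_nat k) * (x + 1 + of_nat k) / (of_nat (Suc k))\<^sup>2)"
  by (simp add: binprod_def)

lemma sqprod_Suc:
  "sqprod (Suc k) x = sqprod k x * ((x\<^sup>2 - (of_nat (Suc k))\<^sup>2) / (of_nat (Suc (Suc k)))\<^sup>2)"
  by (simp add: sqprod_def)

lemma gchoose_Suc: "(x :: rat) gchoose Suc k = (x gchoose k) * (x - of_nat k) / of_nat (Suc k)"
  by (simp add: gbinomial_prod_rev)

lemma binprod_gchoose: "(- 1) ^ k * (x gchoose k) * ((- 1 - x) gchoose k) = binprod k x"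
proof (induction k)
  case (Suc k)
  have "(- 1) ^ Suc k * (x gchoose Suc k) * ((- 1 - x) gchoose Suc k)
      = ((- 1) ^ k * (x gchoose k) * ((- 1 - x) gchoose k))
        * ((x - of_nat k) * (x + 1 + of_nat k) / (of_nat (Suc k))\<^sup>2)"
    unfolding gchoose_Suc by (simp add: power2_eq_square field_simps del: of_nat_Suc)
  then show ?case unfolding Suc.IH binprod_Suc .
qed simp

lemma binprod_of_nat: "of_nat (n choose k) * of_nat ((n + k) choose k) = binprod k (of_nat n)"
proof -
  have "of_nat ((n + k) choose k) = ((of_nat (n + k) :: rat) gchoose k)"
    by (rule binomial_gbinomial)
  also have "\<dots> = (- 1) ^ k * ((- 1 - of_nat n) gchoose k)"
    by (subst gbinomial_negated_upper) (simp add: algebra_simps)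
  finally show ?thesis
    by (simp add: binprod_gchoose[symmetric] binomial_gbinomial mult_ac)
qed

text \<open>The integer coefficient and the factor depending on \<open>x\<close> are the same
  function \<open>binprod k\<close>, taken at \<open>n\<close> and at \<open>x\<close>. Thus the
  recursions in \<open>x\<close> also serve for the coefficients, in particular at
  \<open>n = p - 1\<close>.\<close>

lemma V_binprod: "V n x = (\<Sum>k\<le>n. binprod k (of_nat n) * binprod k x)"
  unfolding V_def
proof (intro sum.cong refl)
  fix k
  show "of_nat (n choose k) * of_nat (n + k choose k) * (- 1) ^ k * (x gchoose k) * (- 1 - x gchoose k)
    = binprod k (of_nat n) * binprod k x"
    by (subst binprod_of_nat[symmetric], subst binprod_gchoose[symmetric]) (simp only: mult.assoc)
qed

lemma binprod_sqprod: "x * sqprod k x = binprod k x * (x - of_nat k) / (of_nat (Suc k))\<^sup>2"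
proof (induction k)
  case (Suc k)
  have "x * sqprod (Suc k) x
      = (x * sqprod k x) * ((x\<^sup>2 - (of_nat (Suc k))\<^sup>2) / (of_nat (Suc (Suc k)))\<^sup>2)"
    by (simp add: sqprod_Suc)
  also have "\<dots> = binprod (Suc k) x * (x - of_nat (Suc k)) / (of_nat (Suc (Suc k)))\<^sup>2"
    unfolding Suc.IH binprod_Suc
    by (simp add: divide_simps del: of_nat_Suc) (simp add: algebra_simps power2_eq_square)
  finally show ?case .
qed simp

lemma binprod_sqprod_Suc:
  "(x + 1) * sqprod k (x + 1) = binprod k x * (x + 1 + of_nat k) / (of_nat (Suc k))\<^sup>2"
proof (induction k)
  case (Suc k)
  have "(x + 1) * sqprod (Suc k) (x + 1)
      = ((x + 1) * sqprod k (x + 1)) * (((x + 1)\<^sup>2 - (of_nat (Suc k))\<^sup>2) / (of_nat (Suc (Suc k)))\<^sup>2)"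
    by (simp add: sqprod_Suc)
  also have "\<dots> = binprod (Suc k) x * (x + 1 + of_nat (Suc k)) / (of_nat (Suc (Suc k)))\<^sup>2"
    unfolding Suc.IH binprod_Suc
    by (simp add: divide_simps del: of_nat_Suc) (simp add: algebra_simps power2_eq_square)
  finally show ?case .
qed simp

lemma binprod_eq: "binprod (Suc k) x = x * (x + of_nat (Suc k)) * sqprod k x"
proof -
  have "binprod (Suc k) x = (x + 1 + of_nat k) * (x * sqprod k x)"
    unfolding binprod_Suc binprod_sqprod by simp
  then show ?thesis by (simp add: algebra_simps)
qed

text \<open>Both values are multiples of \<open>(x + 1) * sqprod k (x + 1)\<close>, with cofactors
  \<open>x + 1 + (k + 1)\<close> and \<open>x + 1 - (k + 1)\<close>.\<close>

lemma binprod_diff: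
  "binprod (Suc k) (x + 1) - binprod (Suc k) x = 2 * of_nat (Suc k) * (x + 1) * sqprod k (x + 1)"
proof -
  have "binprod (Suc k) (x + 1) = (x + 1) * (x + 1 + of_nat (Suc k)) * sqprod k (x + 1)"
    by (rule binprod_eq)
  moreover have "binprod (Suc k) x = (x - of_nat k) * ((x + 1) * sqprod k (x + 1))"
    unfolding binprod_Suc binprod_sqprod_Suc by simp
  ultimately show ?thesis by (simp add: algebra_simps)
qed

lemma binprod_pred_eq: "binprod (Suc k) (x - 1) = x * (x - of_nat (Suc k)) * sqprod k x"
  using binprod_diff[of k "x - 1"] binprod_eq[of k x] by (simp add: algebra_simps)

lemma V_diff:
  "V n x - V n (x - 1) = 2 * x * (\<Sum>k<n. binprod (Suc k) (of_nat n) * of_nat (Suc k) * sqprod k x)"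
proof -
  have "V n x - V n (x - 1) = (\<Sum>k<Suc n. binprod k (of_nat n) * (binprod k x - binprod k (x - 1)))"
    unfolding V_binprod lessThan_Suc_atMost by (simp add: sum_subtractf right_diff_distrib)
  also have "\<dots> = (\<Sum>k<n. binprod (Suc k) (of_nat n) * (binprod (Suc k) x - binprod (Suc k) (x - 1)))"
    unfolding sum.lessThan_Suc_shift by simp
  also have "\<dots> = 2 * x * (\<Sum>k<n. binprod (Suc k) (of_nat n) * of_nat (Suc k) * sqprod k x)"
    unfolding sum_distrib_left binprod_eq[of _ x] binprod_pred_eq
    by (intro sum.cong refl) (simp add: algebra_simps)
  finally show ?thesis .
qed

text \<open>With \<open>P n\<close> for the product on the right,
  \<open>(- 1) ^ n * sqprod n x = P n / (n + 1) ^ 2\<close>, so each summand is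
  \<open>P n - P (n + 1)\<close>.\<close>

lemma sqprod_telescope:
  "(\<Sum>k<n. (- 1) ^ k * x\<^sup>2 * sqprod k x) = 1 - (\<Prod>i<n. 1 - x\<^sup>2 / (of_nat (Suc i))\<^sup>2)"
proof -
  have *: "(- 1) ^ n * sqprod n x = (\<Prod>i<n. 1 - x\<^sup>2 / (of_nat (Suc i))\<^sup>2) / (of_nat (Suc n))\<^sup>2" for n
  proof (induction n)
    case (Suc n)
    have "(- 1) ^ Suc n * sqprod (Suc n) x = ((- 1) ^ n * sqprod n x)
       * (((of_nat (Suc n))\<^sup>2 - x\<^sup>2) / (of_nat (Suc (Suc n)))\<^sup>2)"
      by (simp add: sqprod_Suc del: of_nat_Suc) (simp add: algebra_simps diff_divide_distrib del: of_nat_Suc)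
    also have "\<dots> = (\<Prod>i<Suc n. 1 - x\<^sup>2 / (of_nat (Suc i))\<^sup>2) / (of_nat (Suc (Suc n)))\<^sup>2"
      unfolding Suc.IH prod.lessThan_Suc
      by (simp add: divide_simps del: of_nat_Suc)
    finally show ?case .
  qed simp
  show ?thesis
  proof (induction n)
    case (Suc n)
    have "(- 1) ^ n * x\<^sup>2 * sqprod n x = x\<^sup>2 * ((- 1) ^ n * sqprod n x)" by simp
    then show ?case unfolding sum.lessThan_Suc Suc.IH prod.lessThan_Suc *
      by (simp add: algebra_simps del: of_nat_Suc)
  qed simp
qed

text \<open>
  The summands are, up to sign, those of the Vandermonde convolution for \<open>(1 gchoose (a + 1)) = 0\<close>
  with the index 0 left out.
\<close>

lemma alternating_binprod_sum:
  assumes "0 < a" "a < n"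
  shows "(\<Sum>k<n. (- 1) ^ k * (binprod k (of_nat a) * of_nat a * of_nat (Suc a) / (of_nat (Suc k))\<^sup>2)) = 1"
proof -
  let ?x = "of_nat a :: rat"
  have summand: "binprod k ?x * ?x * of_nat (Suc a) / (of_nat (Suc k))\<^sup>2
     = - ((- 1) ^ k * ((- ?x) gchoose Suc k) * (of_nat (Suc a) gchoose Suc k))" for k
  proof (induction k)
    case (Suc k)
    have R: "(- 1) ^ Suc k * ((- ?x) gchoose Suc (Suc k)) * (of_nat (Suc a) gchoose Suc (Suc k))
      = ((- 1) ^ k * ((- ?x) gchoose Suc k) * (of_nat (Suc a) gchoose Suc k))
        * ((?x - of_nat k) * (?x + 1 + of_nat k) / (of_nat (Suc (Suc k)))\<^sup>2)"
    proof -
      have *: "- ?x - of_nat (Suc k) = - (?x + 1 + of_nat k)" "of_nat (Suc a) - of_nat (Suc k) = ?x - of_nat k"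
        by simp_all
      then show ?thesis
        unfolding gchoose_Suc[of _ "Suc k"] *
        by (simp add: power2_eq_square mult_ac del: of_nat_Suc minus_add_distrib)
    qed
    have L: "binprod (Suc k) ?x * ?x * of_nat (Suc a) / (of_nat (Suc (Suc k)))\<^sup>2
      = (binprod k ?x * ?x * of_nat (Suc a) / (of_nat (Suc k))\<^sup>2)
        * ((?x - of_nat k) * (?x + 1 + of_nat k) / (of_nat (Suc (Suc k)))\<^sup>2)"
      by (simp add: binprod_Suc mult_ac del: of_nat_Suc)
    show ?case unfolding L Suc.IH R by simp
  qed simp
  have "0 = (of_nat (Suc 0) gchoose Suc a :: rat)"
    unfolding binomial_gbinomial[symmetric] using assms by simp
  also have "\<dots> = (\<Sum>k\<le>Suc a. ((- ?x) gchoose k) * (of_nat (Suc a) gchoose (Suc a - k)))"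
    unfolding gbinomial_Vandermonde atMost_atLeast0 by simp
  also have "\<dots> = (\<Sum>k\<le>Suc a. ((- ?x) gchoose k) * (of_nat (Suc a) gchoose k))"
    by (intro sum.cong refl)
       (simp add: binomial_gbinomial[symmetric] binomial_symmetric[symmetric] del: of_nat_Suc)
  \<comment> \<open>Terms beyond \<open>Suc a\<close> vanish, so the range may be extended up to
    \<open>n\<close>. The term of index 0, equal to 1, is the one that the shifted sum
    lacks.\<close>
  also have "\<dots> = (\<Sum>k<Suc n. ((- ?x) gchoose k) * (of_nat (Suc a) gchoose k))"
    using assms by (intro sum.mono_neutral_left)
      (auto simp: binomial_gbinomial[symmetric] simp del: of_nat_Suc)
  finally show ?thesis
    unfolding summand sum.lessThan_Suc_shift
    by (simp add: algebra_simps sum_negf del: of_nat_Suc)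
qed

text \<open>By \<open>binprod_sqprod\<close> and \<open>binprod_sqprod_Suc\<close>, passing from
  \<open>a\<close> to \<open>a + 1\<close> changes the unsigned summand by \<open>2 * a + 1\<close>
  times \<open>binprod k a / (k + 1) ^ 2\<close>. With \<open>alternating_binprod_sum\<close> the
  whole increment is \<open>(2 * a + 1) / (a * (a + 1))\<close>, that is
  \<open>1 / a + 1 / (a + 1)\<close>.\<close>

lemma sqprod_harmonic:
  assumes "0 < a" "a \<le> n"
  shows "(\<Sum>k<n. (- 1) ^ k * (of_nat a)\<^sup>2 * sqprod k (of_nat a) / of_nat (Suc k))
    = 2 * (\<Sum>j=1..a. 1 / of_nat j) - 1 / of_nat a"
  using assms
proof (induction a rule: nat_induct_non_zero)
  case 1
  \<comment> \<open>For \<open>k > 0\<close> the product \<open>sqprod k 1\<close> contains the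
    factor \<open>1 - 1\<close>.\<close>
  have "(\<Sum>k<n. (- 1) ^ k * (of_nat 1)\<^sup>2 * sqprod k (of_nat 1) / of_nat (Suc k))
    = (\<Sum>k<n. if k = 0 then 1 else 0)"
    by (intro sum.cong refl) (auto simp: sqprod_def gr0_conv_Suc intro!: bexI[of _ 0])
  then show ?case using 1 by simp
next
  case (Suc a)
  let ?x = "of_nat a :: rat"
  have eq: "(?x + 1)\<^sup>2 * sqprod k (?x + 1) / of_nat (Suc k) - ?x\<^sup>2 * sqprod k ?x / of_nat (Suc k)
    = (2 * ?x + 1) * (binprod k ?x / (of_nat (Suc k))\<^sup>2)" for k
  proof -
    have "(?x + 1)\<^sup>2 * sqprod k (?x + 1) - ?x\<^sup>2 * sqprod k ?x
      = (?x + 1) * ((?x + 1) * sqprod k (?x + 1)) - ?x * (?x * sqprod k ?x)"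
      by (simp add: power2_eq_square mult.assoc)
    also have "\<dots> = (2 * ?x + 1) * of_nat (Suc k) * (binprod k ?x / (of_nat (Suc k))\<^sup>2)"
      unfolding binprod_sqprod[of ?x] binprod_sqprod_Suc by (simp add: divide_simps) (simp add: algebra_simps)
    finally show ?thesis by (simp add: diff_divide_distrib[symmetric])
  qed
  have "(\<Sum>k<n. (- 1) ^ k * (?x + 1)\<^sup>2 * sqprod k (?x + 1) / of_nat (Suc k))
      - (\<Sum>k<n. (- 1) ^ k * ?x\<^sup>2 * sqprod k ?x / of_nat (Suc k))
    = (\<Sum>k<n. (- 1) ^ k * ((?x + 1)\<^sup>2 * sqprod k (?x + 1) / of_nat (Suc k) - ?x\<^sup>2 * sqprod k ?x / of_nat (Suc k)))"
    by (simp add: sum_subtractf right_diff_distrib mult_ac)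
  also have "\<dots> = (2 * ?x + 1) / (?x * of_nat (Suc a)) *
     (\<Sum>k<n. (- 1) ^ k * (binprod k ?x * ?x * of_nat (Suc a) / (of_nat (Suc k))\<^sup>2))"
    unfolding eq sum_distrib_left using Suc.hyps
    by (intro sum.cong refl) (simp add: divide_simps del: of_nat_Suc)
  also have "\<dots> = 1 / ?x + 1 / (?x + 1)"
    using Suc alternating_binprod_sum[of a n] by (simp add: field_simps)
  finally show ?case using Suc by (simp add: algebra_simps)
qed

lemma sqprod_zero: "sqprod k 0 = (- 1) ^ k / (of_nat (Suc k))\<^sup>2"
proof (induction k)
  case (Suc k)
  show ?case unfolding sqprod_Suc Suc.IH by (simp add: divide_simps del: of_nat_Suc)
qed simp

lemma binprod_zero: "0 < k \<Longrightarrow> binprod k 0 = 0"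
  by (cases k) (auto simp: binprod_eq)

lemma V_zero: "V n 0 = 1"
proof -
  have "V n 0 = (\<Sum>k\<le>n. if k = 0 then 1 else 0)"
    unfolding V_binprod by (intro sum.cong) (auto simp: binprod_zero)
  then show ?thesis by simp
qed

section \<open>Bernoulli polynomials at negative integers\<close>

lemma bernoulli_poly_0: "bernoulli_poly n 0 = bernoulli n"
proof -
  have "bernoulli_poly n 0 = (\<Sum>k\<le>n. if k = n then bernoulli k else 0)"
    unfolding bernoulli_poly_def by (intro sum.cong) auto
  then show ?thesis by simp
qed

text \<open>\<open>bernoulli_poly_diff\<close> at \<open>y = - (m + 1)\<close> gives the induction
  step; for even \<open>n\<close> the odd exponent \<open>n - 1\<close> reverses the sign of the
  power.\<close>

lemma bernoulli_poly_neg_of_nat: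
  assumes "even n" "0 < n"
  shows "bernoulli_poly n (- of_nat m) = bernoulli n + of_nat n * (\<Sum>j=1..m. of_nat j ^ (n - 1))"
proof (induction m)
  case (Suc m)
  have "odd (n - 1)" using assms by simp
  then have "(- of_nat (Suc m)) ^ (n - 1) = - ((of_nat (Suc m) :: rat) ^ (n - 1))"
    by (rule power_minus_odd)
  then show ?case
    using bernoulli_poly_diff[of n "- of_nat (Suc m)"] Suc.IH by (simp add: algebra_simps)
qed (simp add: bernoulli_poly_0)

subsection \<open>The ideals generated by powers of p\<close>

locale odd_prime =
  fixes p :: nat
  assumes prime_p: "prime p" and odd_p: "odd p"
begin

lemma p_ge_3: "p \<ge> 3"
  using prime_p odd_p prime_ge_2_nat[of p] by (cases "p = 2") auto

text \<open>The reduced denominator divides every other denominator of the same rational. With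
  unreduced fractions allowed, closure under the ring operations is plain fraction
  arithmetic.\<close>

lemma Zp_iff: "x \<in> Zp p \<longleftrightarrow> (\<exists>a b. coprime b (int p) \<and> x = of_int a / of_int b)"
proof
  assume "x \<in> Zp p"
  then have "coprime (snd (quotient_of x)) (int p)" by (simp add: Zp_def)
  moreover have "x = of_int (fst (quotient_of x)) / of_int (snd (quotient_of x))"
    by (intro quotient_of_div) simp
  ultimately show "\<exists>a b. coprime b (int p) \<and> x = of_int a / of_int b" by blast
next
  assume "\<exists>a b. coprime b (int p) \<and> x = of_int a / of_int b"
  then obtain a b where b: "coprime b (int p)" "x = of_int a / of_int b" by blast
  obtain c d where cd: "quotient_of x = (c, d)" by force
  have "b \<noteq> 0" using b p_ge_3 by auto
  have "d > 0" "coprime c d" "x = of_int c / of_int d"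
    using quotient_of_denom_pos[OF cd] quotient_of_coprime[OF cd] quotient_of_div[OF cd] by auto
  then have "of_int (a * d) = (of_int (c * b) :: rat)"
    using b(2) \<open>b \<noteq> 0\<close> by (simp add: field_simps)
  then have "a * d = c * b" by (simp only: of_int_eq_iff)
  then have "d dvd b"
    using \<open>coprime c d\<close> by (metis coprime_commute coprime_dvd_mult_right_iff dvd_triv_right)
  then show "x \<in> Zp p"
    using coprime_divisors[OF \<open>d dvd b\<close> dvd_refl b(1)] cd by (simp add: Zp_def)
qed

lemma Zp_of_int [simp, intro]: "of_int a \<in> Zp p"
  unfolding Zp_iff by (intro exI[of _ a] exI[of _ 1]) auto

lemma Zp_of_nat [simp, intro]: "of_nat a \<in> Zp p"
  using Zp_of_int[of "int a"] by simp

lemma Zp_numeral [simp, intro]: "numeral a \<in> Zp p"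
  using Zp_of_int[of "numeral a"] by simp

lemma Zp_0 [simp, intro]: "0 \<in> Zp p" and Zp_1 [simp, intro]: "1 \<in> Zp p"
  using Zp_of_int[of 0] Zp_of_int[of 1] by simp_all

lemma Zp_mult [simp, intro]: "x \<in> Zp p \<Longrightarrow> y \<in> Zp p \<Longrightarrow> x * y \<in> Zp p"
  unfolding Zp_iff
proof clarify
  fix a b c d
  assume "coprime b (int p)" "coprime d (int p)"
  then show "\<exists>a' b'. coprime b' (int p) \<and> of_int a / of_int b * (of_int c / of_int d) = (of_int a' / of_int b' :: rat)"
    by (intro exI[of _ "a * c"] exI[of _ "b * d"]) auto
qed

lemma Zp_uminus [simp, intro]: "x \<in> Zp p \<Longrightarrow> - x \<in> Zp p"
  using Zp_mult[OF Zp_of_int[of "- 1"]] by simp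

lemma Zp_add [simp, intro]: "x \<in> Zp p \<Longrightarrow> y \<in> Zp p \<Longrightarrow> x + y \<in> Zp p"
  unfolding Zp_iff
proof clarify
  fix a b c d
  assume bd: "coprime b (int p)" "coprime d (int p)"
  then have "b \<noteq> 0" "d \<noteq> 0" using p_ge_3 by auto
  with bd show "\<exists>a' b'. coprime b' (int p) \<and> of_int a / of_int b + of_int c / of_int d = (of_int a' / of_int b' :: rat)"
    by (intro exI[of _ "a * d + c * b"] exI[of _ "b * d"]) (auto simp: field_simps)
qed

lemma Zp_diff [simp, intro]: "x \<in> Zp p \<Longrightarrow> y \<in> Zp p \<Longrightarrow> x - y \<in> Zp p"
  using Zp_add[of x "- y"] by auto

lemma Zp_power [simp, intro]: "x \<in> Zp p \<Longrightarrow> x ^ n \<in> Zp p"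
  by (induction n) auto

lemma Zp_sum [intro]: "(\<And>i. i \<in> A \<Longrightarrow> f i \<in> Zp p) \<Longrightarrow> sum f A \<in> Zp p"
  by (induction A rule: infinite_finite_induct) auto

lemma Zp_prod [intro]: "(\<And>i. i \<in> A \<Longrightarrow> f i \<in> Zp p) \<Longrightarrow> prod f A \<in> Zp p"
  by (induction A rule: infinite_finite_induct) auto

lemma Zp_divide_of_nat [intro]:
  assumes "x \<in> Zp p" "\<not> p dvd n"
  shows "x / of_nat n \<in> Zp p"
proof -
  have "coprime (int n) (int p)"
    using assms(2) prime_p by (simp add: prime_imp_coprime coprime_commute[of n])
  then have "1 / of_nat n \<in> Zp p"
    unfolding Zp_iff by (intro exI[of _ 1] exI[of _ "int n"]) auto
  from Zp_mult[OF assms(1) this] show ?thesis by simp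
qed

text \<open>Differences lying in this ideal express congruences separately from the integrality of
  both sides that \<open>cong_Zp\<close> also demands.\<close>

definition ideal :: "nat \<Rightarrow> rat set" ("\<P>") where
  "\<P> r = (*) (of_nat p ^ r) ` Zp p"

lemma cong_Zp_iff: "cong_Zp p r a b \<longleftrightarrow> a \<in> Zp p \<and> b \<in> Zp p \<and> a - b \<in> \<P> r"
  by (auto simp: cong_Zp_def ideal_def)

lemma ideal_0 [simp, intro]: "0 \<in> \<P> r"
  by (auto simp: ideal_def)

lemma ideal_add [intro]: "x \<in> \<P> r \<Longrightarrow> y \<in> \<P> r \<Longrightarrow> x + y \<in> \<P> r"
  by (auto simp: ideal_def distrib_left[symmetric])

lemma ideal_uminus [intro]: "x \<in> \<P> r \<Longrightarrow> - x \<in> \<P> r"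
  unfolding ideal_def
proof clarify
  fix c assume "c \<in> Zp p"
  then show "- (of_nat p ^ r * c) \<in> (*) (of_nat p ^ r) ` Zp p"
    by (intro image_eqI[of _ _ "- c"]) auto
qed

lemma ideal_diff [intro]: "x \<in> \<P> r \<Longrightarrow> y \<in> \<P> r \<Longrightarrow> x - y \<in> \<P> r"
  using ideal_add[of x r "- y"] by auto

lemma ideal_commute: "x - y \<in> \<P> r \<longleftrightarrow> y - x \<in> \<P> r"
  using ideal_uminus[of "x - y" r] ideal_uminus[of "y - x" r] by auto

lemma ideal_mult: "x \<in> \<P> r \<Longrightarrow> y \<in> \<P> s \<Longrightarrow> x * y \<in> \<P> (r + s)"
  unfolding ideal_def
proof clarify
  fix c d assume "c \<in> Zp p" "d \<in> Zp p"
  then show "of_nat p ^ r * c * (of_nat p ^ s * d) \<in> (*) (of_nat p ^ (r + s)) ` Zp p"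
    by (intro image_eqI[of _ _ "c * d"]) (auto simp: power_add)
qed

lemma Zp_eq_ideal: "Zp p = \<P> 0"
  by (auto simp: ideal_def)

lemma ideal_mult_right [intro]: "x \<in> \<P> r \<Longrightarrow> y \<in> Zp p \<Longrightarrow> x * y \<in> \<P> r"
  using ideal_mult[of x r y 0] by (simp add: Zp_eq_ideal)

lemma ideal_mult_left [intro]: "x \<in> Zp p \<Longrightarrow> y \<in> \<P> r \<Longrightarrow> x * y \<in> \<P> r"
  using ideal_mult_right[of y r x] by (simp add: mult.commute)

lemma ideal_mono: "x \<in> \<P> s \<Longrightarrow> r \<le> s \<Longrightarrow> x \<in> \<P> r"
  unfolding ideal_def
proof clarify
  fix c assume "c \<in> Zp p" "r \<le> s"
  then show "of_nat p ^ s * c \<in> (*) (of_nat p ^ r) ` Zp p"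
    by (intro image_eqI[of _ _ "of_nat p ^ (s - r) * c"]) (auto simp: power_add[symmetric] mult.assoc[symmetric])
qed

lemma ideal_subset_Zp: "x \<in> \<P> r \<Longrightarrow> x \<in> Zp p"
  using ideal_mono[of x r 0] by (simp add: Zp_eq_ideal)

lemma ideal_sum [intro]: "(\<And>i. i \<in> A \<Longrightarrow> f i \<in> \<P> r) \<Longrightarrow> sum f A \<in> \<P> r"
  by (induction A rule: infinite_finite_induct) auto

lemma ideal_trans: "x - y \<in> \<P> r \<Longrightarrow> y - z \<in> \<P> r \<Longrightarrow> x - z \<in> \<P> r"
  using ideal_add[of "x - y" r "y - z"] by simp

lemma ideal_diff_add: "a - c \<in> \<P> r \<Longrightarrow> b - d \<in> \<P> r \<Longrightarrow> (a + b) - (c + d) \<in> \<P> r"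
  using ideal_add[of "a - c" r "b - d"] by (simp add: algebra_simps)

lemma ideal_diff_mult:
  assumes "a - c \<in> \<P> r" "b - d \<in> \<P> r" "b \<in> Zp p" "c \<in> Zp p"
  shows "a * b - c * d \<in> \<P> r"
proof -
  have "(a - c) * b + c * (b - d) \<in> \<P> r" using assms by blast
  then show ?thesis by (simp add: algebra_simps)
qed

lemma ideal_diff_power:
  assumes "a - b \<in> \<P> r" "a \<in> Zp p" "b \<in> Zp p"
  shows "a ^ n - b ^ n \<in> \<P> r"
  by (induction n) (use assms in \<open>auto intro!: ideal_diff_mult\<close>)

lemma ideal_diff_sum:
  "(\<And>i. i \<in> A \<Longrightarrow> f i - g i \<in> \<P> r) \<Longrightarrow> sum f A - sum g A \<in> \<P> r"
  by (simp add: sum_subtractf[symmetric] ideal_sum)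

lemma ideal_p_power: "c \<in> Zp p \<Longrightarrow> of_nat p ^ r * c \<in> \<P> r"
  unfolding ideal_def by (rule imageI)

lemma ideal_cancel: "of_nat p ^ s * x \<in> \<P> (s + r) \<longleftrightarrow> x \<in> \<P> r"
  using p_ge_3 by (auto simp: ideal_def power_add mult.assoc)

lemma ideal_p_mult_iff: "of_nat p * x \<in> \<P> (Suc r) \<longleftrightarrow> x \<in> \<P> r"
  using ideal_cancel[of 1 x r] by simp

lemma of_int_ideal: "int p ^ r dvd a \<Longrightarrow> of_int a \<in> \<P> r"
  by (elim dvdE) (simp add: ideal_p_power)

lemma of_nat_ideal: "p ^ r dvd a \<Longrightarrow> of_nat a \<in> \<P> r"
  by (elim dvdE) (simp add: ideal_p_power)

lemma ideal_of_nat_diff: "[a = b] (mod p ^ r) \<Longrightarrow> of_nat a - of_nat b \<in> \<P> r"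
  using of_int_ideal[of r "int a - int b"] by (simp add: cong_int_iff[symmetric] cong_iff_dvd_diff)

lemma ideal_inverse_diff:
  assumes "of_nat a - of_nat b \<in> \<P> r" "\<not> p dvd a" "\<not> p dvd b"
  shows "1 / of_nat a - 1 / of_nat b \<in> \<P> r"
proof -
  have "(of_nat b - of_nat a) * (1 / of_nat a / of_nat b) \<in> \<P> r"
    using assms(1) by (intro ideal_mult_right Zp_divide_of_nat Zp_1 assms) (simp only: ideal_commute)
  moreover have "a \<noteq> 0" "b \<noteq> 0" using assms by (auto intro: Nat.gr0I)
  ultimately show ?thesis by (simp add: field_simps)
qed

lemma ideal_half: "2 * x \<in> \<P> r \<Longrightarrow> x \<in> \<P> r"
proof -
  assume "2 * x \<in> \<P> r"
  moreover have "\<not> p dvd 2" using p_ge_3 by (auto dest: dvd_imp_le)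
  then have "1 / of_nat 2 \<in> Zp p" by blast
  ultimately have "(2 * x) * (1 / of_nat 2) \<in> \<P> r" by blast
  then show ?thesis by simp
qed

text \<open>The denominator \<open>b\<close> has an inverse \<open>c\<close> modulo
  \<open>p ^ r\<close>; the residue of \<open>a * c\<close> serves as \<open>m\<close>.\<close>

lemma Zp_approx:
  assumes "x \<in> Zp p"
  obtains m where "x - of_nat m \<in> \<P> r"
proof -
  obtain a b where ab: "coprime b (int p)" "x = of_int a / of_int b"
    using assms unfolding Zp_iff by (elim exE conjE)
  then have "b \<noteq> 0" using p_ge_3 by auto
  have "coprime b (int p ^ r)" using ab by simp
  then obtain c where c: "[b * c = 1] (mod int p ^ r)"
    using cong_solve_coprime_int[of b "int p ^ r"] by blast
  define m where "m = nat ((a * c) mod int p ^ r)"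
  have "int m = (a * c) mod int p ^ r" using p_ge_3 by (simp add: m_def)
  then have "[int m = a * c] (mod int p ^ r)" by (simp add: cong_def)
  then have "[b * int m = b * (a * c)] (mod int p ^ r)" by (intro cong_mult cong_refl)
  also have "[b * (a * c) = a * 1] (mod int p ^ r)"
    using cong_mult[OF cong_refl[of a] c] by (simp add: algebra_simps)
  finally have "of_int (a * 1 - b * int m) \<in> \<P> r"
    by (intro of_int_ideal) (simp add: cong_iff_dvd_diff dvd_diff_commute)
  moreover have "1 / of_int b \<in> Zp p"
    unfolding Zp_iff by (intro exI[of _ 1] exI[of _ b]) (simp add: ab)
  ultimately have "of_int (a * 1 - b * int m) * (1 / of_int b) \<in> \<P> r" by blast
  then have "x - of_nat m \<in> \<P> r" using \<open>b \<noteq> 0\<close> by (simp add: ab(2) diff_divide_distrib)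
  then show ?thesis by (rule that)
qed

subsection \<open>Harmonic sums over units\<close>

definition harm :: "nat \<Rightarrow> rat" where
  "harm m = (\<Sum>j=1..m. if p dvd j then 0 else 1 / of_nat j)"

lemma harm_0 [simp]: "harm 0 = 0"
  by (simp add: harm_def)

lemma harm_Suc: "harm (Suc m) = harm m + (if p dvd Suc m then 0 else 1 / of_nat (Suc m))"
  by (simp add: harm_def)

lemma harm_summand_Zp: "(if p dvd j then 0 else 1 / of_nat j) \<in> Zp p"
  by (auto intro: Zp_divide_of_nat)

lemma harm_Zp [simp, intro]: "harm m \<in> Zp p"
  unfolding harm_def by (intro Zp_sum harm_summand_Zp)

text \<open>For a unit \<open>j\<close>, the sum of \<open>1 / j\<close> and
  \<open>1 / (p ^ r - j)\<close> has numerator \<open>p ^ r\<close> over a denominator prime to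
  \<open>p\<close>; multiples of \<open>p\<close> are paired with each other.\<close>

lemma harm_summand_reflect:
  assumes "0 < r" "j \<le> p ^ r"
  shows "(if p dvd j then 0 else 1 / of_nat j)
    + (if p dvd p ^ r - j then 0 else 1 / of_nat (p ^ r - j)) \<in> \<P> r"
proof -
  have dvd: "p dvd p ^ r - j \<longleftrightarrow> p dvd j"
    using assms dvd_diffD1[of p "p ^ r" j] by (auto intro: dvd_diff_nat)
  show ?thesis
  proof (cases "p dvd j")
    case False
    have nz: "j \<noteq> 0" "p ^ r - j \<noteq> 0" using False dvd by (metis dvd_0_right)+
    have "of_nat p ^ r * (1 / of_nat (p ^ r - j) / of_nat j) \<in> \<P> r"
      by (intro ideal_p_power Zp_divide_of_nat Zp_1) (use False dvd in auto)
    moreover have "(of_nat p ^ r :: rat) = of_nat j + of_nat (p ^ r - j)"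
      using assms(2) by (metis le_add_diff_inverse of_nat_add of_nat_power)
    ultimately show ?thesis using False dvd nz
      by (simp add: field_simps del: of_nat_diff)
  qed (simp add: dvd)
qed

text \<open>Reversing the order pairs \<open>j\<close> with \<open>p ^ r - j\<close>, so twice the
  sum lies in the ideal, and 2 is invertible since \<open>p\<close> is odd.\<close>

lemma harm_prime_power:
  assumes "0 < r"
  shows "harm (p ^ r) \<in> \<P> r"
proof -
  let ?f = "\<lambda>j. if p dvd j then 0 else 1 / of_nat j :: rat"
  obtain M where M: "p ^ r = Suc M"
    using p_ge_3 by (metis not_numeral_le_zero power_not_zero old.nat.exhaust)
  have "p dvd Suc M" using assms M by (metis dvd_power)
  then have h: "harm (p ^ r) = sum ?f {1..<p ^ r}"
    unfolding M harm_Suc by (simp add: harm_def atLeastLessThanSuc_atLeastAtMost)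
  also have "\<dots> = sum (\<lambda>j. ?f (p ^ r - j)) {1..<p ^ r}"
    by (subst sum.atLeastLessThan_rev) (simp only: Suc_eq_plus1 add_diff_cancel_right)
  finally have "2 * harm (p ^ r) = (\<Sum>j\<in>{1..<p ^ r}. ?f j + ?f (p ^ r - j))"
    using h by (simp add: sum.distrib)
  also have "\<dots> \<in> \<P> r"
    by (intro ideal_sum harm_summand_reflect assms) auto
  finally show ?thesis by (rule ideal_half)
qed

lemma harm_add_period:
  assumes "0 < r"
  shows "harm (m + p ^ r) - harm m \<in> \<P> r"
proof (induction m)
  case 0
  then show ?case using harm_prime_power[OF assms] by simp
next
  case (Suc m)
  have dvd: "p dvd Suc (m + p ^ r) \<longleftrightarrow> p dvd Suc m"
    using assms by (metis add_Suc dvd_add_left_iff dvd_power)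
  have "(if p dvd Suc (m + p ^ r) then 0 else 1 / of_nat (Suc (m + p ^ r)))
    - (if p dvd Suc m then 0 else 1 / of_nat (Suc m)) \<in> \<P> r"
  proof (cases "p dvd Suc m")
    case False
    have "1 / of_nat (Suc (m + p ^ r)) - 1 / of_nat (Suc m) \<in> \<P> r"
      by (intro ideal_inverse_diff ideal_of_nat_diff) (use False dvd in \<open>auto simp: cong_def mod_Suc\<close>)
    then show ?thesis using False dvd by simp
  qed (simp add: dvd)
  from ideal_add[OF Suc.IH this] show ?case
    by (simp add: harm_Suc algebra_simps del: of_nat_Suc)
qed

lemma harm_mod:
  assumes "0 < r"
  shows "harm m - harm (m mod p ^ r) \<in> \<P> r"
proof -
  have "harm (m mod p ^ r + k * p ^ r) - harm (m mod p ^ r) \<in> \<P> r" for k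
  proof (induction k)
    case (Suc k)
    have "harm ((m mod p ^ r + k * p ^ r) + p ^ r) - harm (m mod p ^ r + k * p ^ r) \<in> \<P> r"
      by (rule harm_add_period[OF assms])
    from ideal_trans[OF this Suc.IH] show ?case by (simp add: algebra_simps)
  qed simp
  from this[of "m div p ^ r"] show ?thesis by (simp only: mod_div_mult_eq)
qed

lemma harm_cong:
  assumes "0 < r" "[m = n] (mod p ^ r)"
  shows "harm m - harm n \<in> \<P> r"
  using harm_mod[OF assms(1), of m] harm_mod[OF assms(1), of n] assms(2)
  by (metis cong_def ideal_commute ideal_trans)

text \<open>Induction on \<open>j\<close>, starting from
  \<open>harm (p ^ r - 1) = harm (p ^ r)\<close>: each step lowers the difference by the reflected
  pair \<open>j + 1\<close> and \<open>p ^ r - (j + 1)\<close>.\<close>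

lemma harm_reflect:
  assumes "0 < r" "j < p ^ r"
  shows "harm (p ^ r - 1 - j) - harm j \<in> \<P> r"
  using assms(2)
proof (induction j)
  case 0
  have "harm (p ^ r) = harm (p ^ r - 1)"
    using harm_Suc[of "p ^ r - 1"] 0 assms(1) by (simp add: dvd_power)
  then show ?case using harm_prime_power[OF assms(1)] by simp
next
  case (Suc j)
  have *: "harm (p ^ r - 1 - j) - harm j
     - ((if p dvd Suc j then 0 else 1 / of_nat (Suc j))
    + (if p dvd p ^ r - Suc j then 0 else 1 / of_nat (p ^ r - Suc j))) \<in> \<P> r"
    by (intro ideal_diff Suc.IH harm_summand_reflect assms(1)) (use Suc.prems in auto)
  have "p ^ r - 1 - j = Suc (p ^ r - 1 - Suc j)" "p ^ r - Suc j = Suc (p ^ r - 1 - Suc j)"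
    using Suc.prems by auto
  then have "harm (p ^ r - 1 - j) = harm (p ^ r - 1 - Suc j)
     + (if p dvd p ^ r - Suc j then 0 else 1 / of_nat (p ^ r - Suc j))"
    using harm_Suc by metis
  with * show ?case by (simp only: harm_Suc) (simp add: algebra_simps del: of_nat_diff of_nat_Suc)
qed

section \<open>Units modulo powers of p and their permutations\<close>

definition units :: "nat \<Rightarrow> nat set" where
  "units r = {a. a < p ^ r \<and> \<not> p dvd a}"

lemma finite_units [simp]: "finite (units r)"
  by (simp add: units_def)

lemma units_totatives: "0 < r \<Longrightarrow> units r = totatives (p ^ r)"
proof -
  assume r: "0 < r"
  have "coprime a (p ^ r) \<longleftrightarrow> \<not> p dvd a" for a
  proof
    assume "coprime a (p ^ r)"
    then have "coprime p a" using r by (simp add: coprime_commute)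
    then show "\<not> p dvd a" using p_ge_3 by (auto simp: coprime_absorb_left)
  next
    assume "\<not> p dvd a"
    then have "coprime p a" by (rule prime_imp_coprime[OF prime_p])
    then show "coprime a (p ^ r)" by (simp add: coprime_commute)
  qed
  moreover have "0 < a \<and> a \<noteq> p ^ r" if "\<not> p dvd a" for a
    using that r by (metis dvd_0_right dvd_power gr0I)
  ultimately show ?thesis
    by (auto simp: units_def totatives_def le_less)
qed

lemma card_units: "0 < r \<Longrightarrow> card (units r) = p ^ (r - 1) * (p - 1)"
  using totient_prime_power[OF prime_p, of r] by (simp add: units_totatives totient_def)

lemma bij_units:
  assumes "0 < r" "\<not> p dvd d"
  shows "bij_betw (\<lambda>a. d * a mod p ^ r) (units r) (units r)"
proof -
  let ?f = "\<lambda>a. d * a mod p ^ r"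
  have cop: "coprime d (p ^ r)"
    using assms(2) prime_p by (simp add: prime_imp_coprime coprime_commute[of d])
  have "inj_on ?f (units r)"
  proof (rule inj_onI)
    fix a b assume ab: "a \<in> units r" "b \<in> units r" "d * a mod p ^ r = d * b mod p ^ r"
    then have "[a = b] (mod p ^ r)"
      using cop by (simp add: cong_def[symmetric] cong_mult_lcancel_nat coprime_commute)
    then show "a = b" using ab by (simp add: units_def cong_def)
  qed
  moreover have "?f ` units r \<subseteq> units r"
  proof clarify
    fix a assume a: "a \<in> units r"
    then have "\<not> p dvd d * a"
      using assms(2) prime_p by (simp add: units_def prime_dvd_mult_iff)
    then have "\<not> p dvd ?f a"
      using assms(1) by (simp add: dvd_mod_iff dvd_power)
    then show "?f a \<in> units r"
      using p_ge_3 by (simp add: units_def)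
  qed
  ultimately show ?thesis
    by (simp add: bij_betw_def endo_inj_surj)
qed

lemma ideal_prod:
  assumes "finite A" "i \<in> A" "f i \<in> \<P> r" "\<And>j. j \<in> A \<Longrightarrow> f j \<in> Zp p"
  shows "prod f A \<in> \<P> r"
proof -
  have "prod f A = f i * prod f (A - {i})" using assms by (simp add: prod.remove)
  also have "\<dots> \<in> \<P> r" using assms by (intro ideal_mult_right Zp_prod) auto
  finally show ?thesis .
qed

lemma ideal_divide_of_nat: "x \<in> \<P> r \<Longrightarrow> \<not> p dvd n \<Longrightarrow> x / of_nat n \<in> \<P> r"
  using ideal_mult_right[of x r "1 / of_nat n"] Zp_divide_of_nat[of 1 n] by simp

lemma ideal_diff_divide:
  "x - y \<in> \<P> r \<Longrightarrow> \<not> p dvd n \<Longrightarrow> x / of_nat n - y / of_nat n \<in> \<P> r"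
  by (simp add: diff_divide_distrib[symmetric] ideal_divide_of_nat)

lemma not_dvd_below: "0 < n \<Longrightarrow> n < p \<Longrightarrow> \<not> p dvd n"
  by (auto dest: dvd_imp_le)

lemma not_dvd_power: "\<not> p dvd n \<Longrightarrow> \<not> p dvd n ^ k"
  using prime_p prime_dvd_power by blast

section \<open>Integrality and p-adic continuity of \<open>V\<close>\<close>

lemma binprod_Zp:
  assumes "k < p" "x \<in> Zp p"
  shows "binprod k x \<in> Zp p"
  unfolding binprod_def of_nat_power[symmetric]
  using assms by (intro Zp_prod Zp_divide_of_nat Zp_mult not_dvd_power not_dvd_below) auto

lemma binprod_cong:
  assumes "k < p" "x \<in> Zp p" "y \<in> Zp p" "x - y \<in> \<P> r"
  shows "binprod k x - binprod k y \<in> \<P> r"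
  using assms(1)
proof (induction k)
  case (Suc k)
  have "(x - of_nat k) * (x + 1 + of_nat k) - (y - of_nat k) * (y + 1 + of_nat k) \<in> \<P> r"
    by (intro ideal_diff_mult) (use assms in auto)
  then have "(x - of_nat k) * (x + 1 + of_nat k) / of_nat ((Suc k)\<^sup>2)
    - (y - of_nat k) * (y + 1 + of_nat k) / of_nat ((Suc k)\<^sup>2) \<in> \<P> r"
    using Suc.prems by (intro ideal_diff_divide not_dvd_power not_dvd_below) auto
  moreover have "(x - of_nat k) * (x + 1 + of_nat k) / of_nat ((Suc k)\<^sup>2) \<in> Zp p"
    using Suc.prems assms by (intro Zp_divide_of_nat not_dvd_power not_dvd_below) auto
  ultimately show ?case
    unfolding binprod_Suc of_nat_power[symmetric]
    using Suc assms by (intro ideal_diff_mult binprod_Zp) auto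
qed simp

text \<open>The denominators reach \<open>Suc k\<close>, one further than for
  \<open>binprod k\<close>; hence the bound \<open>p - 1\<close>.\<close>

lemma sqprod_Zp:
  assumes "k < p - 1" "x \<in> Zp p"
  shows "sqprod k x \<in> Zp p"
  unfolding sqprod_def of_nat_power[symmetric]
  using assms by (intro Zp_prod Zp_divide_of_nat Zp_diff Zp_power not_dvd_power not_dvd_below Zp_of_nat) auto

text \<open>Only \<open>x ^ 2\<close> enters \<open>sqprod\<close>, so congruent squares suffice.
  Comparing the arguments \<open>p\<close> and 0, this gives precision \<open>p ^ 2\<close> instead
  of \<open>p\<close>.\<close>

lemma sqprod_cong:
  assumes "k < p - 1" "x \<in> Zp p" "y \<in> Zp p" "x\<^sup>2 - y\<^sup>2 \<in> \<P> r"
  shows "sqprod k x - sqprod k y \<in> \<P> r"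
  using assms(1)
proof (induction k)
  case (Suc k)
  have "(x\<^sup>2 - (of_nat (Suc k))\<^sup>2) - (y\<^sup>2 - (of_nat (Suc k))\<^sup>2) \<in> \<P> r"
    using assms by simp
  then have "(x\<^sup>2 - (of_nat (Suc k))\<^sup>2) / of_nat ((Suc (Suc k))\<^sup>2)
    - (y\<^sup>2 - (of_nat (Suc k))\<^sup>2) / of_nat ((Suc (Suc k))\<^sup>2) \<in> \<P> r"
    using Suc.prems by (intro ideal_diff_divide not_dvd_power not_dvd_below) auto
  moreover have "(x\<^sup>2 - (of_nat (Suc k))\<^sup>2) / of_nat ((Suc (Suc k))\<^sup>2) \<in> Zp p"
    using Suc.prems assms by (intro Zp_divide_of_nat not_dvd_power not_dvd_below Zp_diff Zp_power Zp_of_nat) auto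
  ultimately show ?case
    unfolding sqprod_Suc of_nat_power[symmetric, of "Suc (Suc k)"]
    using Suc assms by (intro ideal_diff_mult sqprod_Zp) auto
qed simp

lemma V_Zp:
  assumes "x \<in> Zp p"
  shows "V (p - 1) x \<in> Zp p"
  unfolding V_binprod using assms p_ge_3 by (intro Zp_sum Zp_mult binprod_Zp) auto

lemma V_cong:
  assumes "x \<in> Zp p" "y \<in> Zp p" "x - y \<in> \<P> r"
  shows "V (p - 1) x - V (p - 1) y \<in> \<P> r"
  unfolding V_binprod
  using assms p_ge_3 by (intro ideal_diff_sum ideal_diff_mult binprod_cong binprod_Zp) auto

subsection \<open>The congruence for V at natural numbers\<close>

text \<open>What remains of the sum in \<open>V_diff\<close> for \<open>n = p - 1\<close> once
  \<open>binprod_pred_eq\<close> at \<open>p\<close> has extracted a factor \<open>p\<close> and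
  \<open>sqprod k p\<close> is replaced by \<open>sqprod k 0\<close>, which is
  \<open>(- 1) ^ k / (k + 1) ^ 2\<close>.\<close>

definition step_sum :: "rat \<Rightarrow> rat" where
  "step_sum x = (\<Sum>k<p - 1. (of_nat p / of_nat (Suc k) - 1) * (- 1) ^ k * sqprod k x)"

lemma not_dvd_Suc: "k < p - 1 \<Longrightarrow> \<not> p dvd Suc k"
  by (rule not_dvd_below) auto

lemma neg_one_power_Zp [simp, intro]: "(- 1) ^ k \<in> Zp p"
  by (intro Zp_power Zp_uminus Zp_1)

lemma of_nat_pred: "(of_nat (p - 1) :: rat) = of_nat p - 1"
  using p_ge_3 by (simp add: of_nat_diff)

text \<open>The error comes from replacing \<open>sqprod k p\<close> by \<open>sqprod k 0\<close>.
  As \<open>sqprod\<close> is even in its argument, this costs a multiple of \<open>p ^ 2\<close>,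
  and the factor \<open>p\<close> of the coefficient supplies the third power.\<close>

lemma V_step:
  assumes "x \<in> Zp p"
  shows "V (p - 1) x - V (p - 1) (x - 1) - 2 * of_nat p * x * step_sum x \<in> \<P> 3"
proof -
  let ?g = "\<lambda>k. (of_nat p - of_nat (Suc k)) * of_nat (Suc k) * sqprod k x"
  have "V (p - 1) x - V (p - 1) (x - 1) - 2 * of_nat p * x * step_sum x
    = 2 * x * (\<Sum>k<p - 1. of_nat p * (sqprod k (of_nat p) - sqprod k 0) * ?g k)"
    unfolding V_diff step_sum_def of_nat_pred binprod_pred_eq sqprod_zero
      mult.assoc sum_distrib_left sum_subtractf[symmetric]
    by (intro sum.cong refl) (simp add: divide_simps power2_eq_square del: of_nat_Suc, simp add: algebra_simps del: of_nat_Suc)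
  also have "\<dots> \<in> \<P> 3"
  proof (rule ideal_mult_left[OF Zp_mult[OF Zp_numeral assms]], rule ideal_sum)
    fix k assume k: "k \<in> {..<p - 1}"
    have "sqprod k (of_nat p) - sqprod k 0 \<in> \<P> 2"
      by (rule sqprod_cong) (use k ideal_p_power[of 1 2] in auto)
    then have "of_nat p * (sqprod k (of_nat p) - sqprod k 0) \<in> \<P> (Suc 2)"
      by (simp only: ideal_p_mult_iff)
    moreover have "?g k \<in> Zp p"
      using k assms by (intro Zp_mult sqprod_Zp Zp_diff) (auto simp del: of_nat_Suc)
    ultimately have "of_nat p * (sqprod k (of_nat p) - sqprod k 0) * ?g k \<in> \<P> (Suc 2)"
      by (rule ideal_mult_right)
    then show "of_nat p * (sqprod k (of_nat p) - sqprod k 0) * ?g k \<in> \<P> 3"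
      by (simp add: numeral_3_eq_3 numeral_2_eq_2)
  qed
  finally show ?thesis .
qed

text \<open>Modulo \<open>p\<close> the terms with \<open>p / (k + 1)\<close> vanish, and
  \<open>sqprod k x\<close> becomes \<open>sqprod k 0\<close>, whose sign cancels
  \<open>(- 1) ^ k\<close>.\<close>

lemma step_sum_cong_dvd:
  assumes "x \<in> \<P> 1"
  shows "step_sum x + (\<Sum>k<p - 1. 1 / (of_nat (Suc k))\<^sup>2) \<in> \<P> 1"
proof -
  have "step_sum x + (\<Sum>k<p - 1. 1 / (of_nat (Suc k))\<^sup>2)
    = (\<Sum>k<p - 1. of_nat p * (1 / of_nat (Suc k) * ((- 1) ^ k * sqprod k x)) - (- 1) ^ k * (sqprod k x - sqprod k 0))"
    unfolding step_sum_def sqprod_zero sum.distrib[symmetric]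
    by (intro sum.cong refl) (simp add: algebra_simps power_mult_distrib[symmetric] flip: power_add del: of_nat_Suc)
  also have "\<dots> \<in> \<P> 1"
  proof (rule ideal_sum)
    fix k assume "k \<in> {..<p - 1}"
    then have k: "k < p - 1" by simp
    have "x\<^sup>2 - 0\<^sup>2 \<in> \<P> 1"
      using assms ideal_subset_Zp[OF assms] by (auto simp: power2_eq_square)
    then have "sqprod k x - sqprod k 0 \<in> \<P> 1"
      using k ideal_subset_Zp[OF assms] by (intro sqprod_cong) auto
    then have 1: "(- 1) ^ k * (sqprod k x - sqprod k 0) \<in> \<P> 1"
      by (intro ideal_mult_left neg_one_power_Zp)
    have "1 / of_nat (Suc k) * ((- 1) ^ k * sqprod k x) \<in> Zp p"
      using k ideal_subset_Zp[OF assms]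
      by (intro Zp_mult Zp_divide_of_nat sqprod_Zp not_dvd_Suc neg_one_power_Zp Zp_1)
    from ideal_diff[OF ideal_p_power[OF this, of 1] 1]
    show "of_nat p * (1 / of_nat (Suc k) * ((- 1) ^ k * sqprod k x)) - (- 1) ^ k * (sqprod k x - sqprod k 0) \<in> \<P> 1"
      by simp
  qed
  finally show ?thesis .
qed

text \<open>Doubling permutes the units modulo \<open>p\<close> and divides the sum by 4. So three
  quarters of the sum vanish modulo \<open>p\<close>, and 3 is invertible for
  \<open>p > 3\<close>.\<close>

lemma sum_inverse_squares:
  assumes "p > 3"
  shows "(\<Sum>k<p - 1. 1 / (of_nat (Suc k))\<^sup>2) \<in> \<P> 1"
proof -
  have units: "units 1 = Suc ` {..<p - 1}"
  proof (intro equalityI subsetI)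
    fix a assume "a \<in> units 1"
    then have "a < p" "a \<noteq> 0" by (cases "a = 0"; simp add: units_def)+
    then show "a \<in> Suc ` {..<p - 1}" by (intro image_eqI[of _ _ "a - 1"]) auto
  qed (use not_dvd_Suc in \<open>auto simp: units_def\<close>)
  define S where "S = (\<Sum>a\<in>units 1. 1 / of_nat (a\<^sup>2) :: rat)"
  have two: "\<not> p dvd 2" using p_ge_3 by (auto dest: dvd_imp_le)
  have "S = (\<Sum>a\<in>units 1. 1 / of_nat ((2 * a mod p ^ 1)\<^sup>2))"
    unfolding S_def by (rule sum.reindex_bij_betw[OF bij_units[OF _ two], symmetric]) simp
  also have "(\<Sum>a\<in>units 1. 1 / of_nat ((2 * a mod p ^ 1)\<^sup>2)) - (\<Sum>a\<in>units 1. 1 / of_nat ((2 * a)\<^sup>2)) \<in> \<P> 1"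
  proof (intro ideal_diff_sum ideal_inverse_diff ideal_of_nat_diff not_dvd_power)
    fix a assume a: "a \<in> units 1"
    show "[(2 * a mod p ^ 1)\<^sup>2 = (2 * a)\<^sup>2] (mod p ^ 1)"
      by (intro cong_pow) (simp add: cong_def)
    show "\<not> p dvd 2 * a" using a two prime_p by (auto simp: units_def prime_dvd_mult_iff)
    then show "\<not> p dvd 2 * a mod p ^ 1" by (simp add: dvd_mod_iff)
  qed
  finally have "S - (\<Sum>a\<in>units 1. 1 / of_nat ((2 * a)\<^sup>2)) \<in> \<P> 1" .
  also have "(\<Sum>a\<in>units 1. 1 / of_nat ((2 * a)\<^sup>2)) = S / 4"
    unfolding S_def sum_divide_distrib by (intro sum.cong) (auto simp: power_mult_distrib)
  finally have "S - S / 4 \<in> \<P> 1" .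
  moreover have "\<not> p dvd 3" using assms by (auto dest: dvd_imp_le)
  ultimately have "4 * (S - S / 4) / of_nat 3 \<in> \<P> 1"
    by (intro ideal_divide_of_nat ideal_mult_left Zp_numeral)
  then have "S \<in> \<P> 1" by (simp add: field_simps)
  also have "S = (\<Sum>k<p - 1. 1 / (of_nat (Suc k))\<^sup>2)"
    unfolding S_def units by (subst sum.reindex) (auto simp del: of_nat_Suc)
  finally show ?thesis .
qed

lemma step_sum_unit:
  assumes m: "\<not> p dvd m"
  shows "(of_nat m)\<^sup>2 * step_sum (of_nat m) + 1 - of_nat p * (2 * harm m - 1 / of_nat m) \<in> \<P> 2"
proof -
  define x :: rat where "x = of_nat m"
  define a where "a = m mod p"
  have x: "x \<in> Zp p" by (simp add: x_def)
  have a: "0 < a" "a < p" using m p_ge_3 by (auto simp: a_def dvd_eq_mod_eq_0)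
  have xa: "x - of_nat a \<in> \<P> 1"
    unfolding x_def a_def by (intro ideal_of_nat_diff) (simp add: cong_def)
  \<comment> \<open>Splitting \<open>1 - x ^ 2 / i ^ 2\<close> into
    \<open>(1 - x / i) * (1 + x / i)\<close> exhibits two factors divisible by \<open>p\<close>: in
    the first product at \<open>i = a\<close>, in the second at \<open>i = p - a\<close>.\<close>
  define Q where "Q = (\<Prod>i<p - 1. 1 - x\<^sup>2 / (of_nat (Suc i))\<^sup>2)"
  have "Q = (\<Prod>i<p - 1. (of_nat (Suc i) - x) / of_nat (Suc i)) * (\<Prod>i<p - 1. (of_nat (Suc i) + x) / of_nat (Suc i))"
    unfolding Q_def prod.distrib[symmetric]
    by (intro prod.cong refl) (simp add: field_simps power2_eq_square del: of_nat_Suc)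
  also have "\<dots> \<in> \<P> (1 + 1)"
  proof (intro ideal_mult)
    have "(of_nat (Suc (a - 1)) - x) / of_nat (Suc (a - 1)) \<in> \<P> 1"
      using a xa by (intro ideal_divide_of_nat not_dvd_Suc) (auto simp: ideal_commute)
    then show "(\<Prod>i<p - 1. (of_nat (Suc i) - x) / of_nat (Suc i)) \<in> \<P> 1"
      by (rule ideal_prod[rotated 2]) (use a x in \<open>auto intro!: Zp_divide_of_nat not_dvd_Suc simp del: of_nat_Suc\<close>)
    have "of_nat (Suc (p - a - 1)) + x = of_nat p + (x - of_nat a)"
      using a by (simp add: of_nat_diff)
    also have "\<dots> \<in> \<P> 1" using xa ideal_p_power[of 1 1] by auto
    finally have "(of_nat (Suc (p - a - 1)) + x) / of_nat (Suc (p - a - 1)) \<in> \<P> 1"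
      using a by (intro ideal_divide_of_nat not_dvd_Suc) auto
    then show "(\<Prod>i<p - 1. (of_nat (Suc i) + x) / of_nat (Suc i)) \<in> \<P> 1"
      by (rule ideal_prod[rotated 2]) (use a x in \<open>auto intro!: Zp_divide_of_nat not_dvd_Suc simp del: of_nat_Suc\<close>)
  qed
  finally have Q: "Q \<in> \<P> 2" by (simp add: numeral_2_eq_2)

  \<comment> \<open>This part is multiplied by \<open>p\<close>, so it matters only modulo
    \<open>p\<close>. There \<open>x\<close> may be replaced by its residue \<open>a\<close>, which
    lies in the range of \<open>sqprod_harmonic\<close>.\<close>
  define F where "F y = (\<Sum>k<p - 1. (- 1) ^ k * y\<^sup>2 * sqprod k y / of_nat (Suc k))" for y
  have "F x - F (of_nat a) \<in> \<P> 1"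
    unfolding F_def
  proof (intro ideal_diff_sum)
    fix k assume "k \<in> {..<p - 1}"
    then have k: "k < p - 1" by simp
    have sq: "x\<^sup>2 - (of_nat a)\<^sup>2 \<in> \<P> 1"
      using xa x by (intro ideal_diff_power) auto
    show "(- 1) ^ k * x\<^sup>2 * sqprod k x / of_nat (Suc k)
      - (- 1) ^ k * (of_nat a)\<^sup>2 * sqprod k (of_nat a) / of_nat (Suc k) \<in> \<P> 1"
      by (intro ideal_diff_divide not_dvd_Suc[OF k] ideal_diff_mult sq sqprod_cong[OF k] sqprod_Zp[OF k])
         (use x in auto)
  qed
  moreover have "F (of_nat a) = 2 * harm a - 1 / of_nat a"
  proof -
    \<comment> \<open>No \<open>j \<le> a < p\<close> is a multiple of \<open>p\<close>, so
      \<open>harm a\<close> is the full harmonic sum.\<close>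
    have "(\<Sum>j=1..a. 1 / of_nat j) = harm a"
      unfolding harm_def using a by (intro sum.cong refl) (auto dest: dvd_imp_le)
    then show ?thesis
      unfolding F_def using sqprod_harmonic[of a "p - 1"] a by simp
  qed
  moreover have "2 * harm m - 1 / of_nat m - (2 * harm a - 1 / of_nat a) \<in> \<P> 1"
  proof -
    have "harm m - harm a \<in> \<P> 1"
      using harm_mod[of 1 m] by (simp add: a_def)
    moreover have "1 / of_nat m - 1 / of_nat a \<in> \<P> 1"
      using xa m not_dvd_below[OF a] by (intro ideal_inverse_diff) (auto simp: x_def)
    ultimately have "2 * (harm m - harm a) - (1 / of_nat m - 1 / of_nat a) \<in> \<P> 1"
      by (rule ideal_diff[OF ideal_mult_left[OF Zp_numeral]])
    then show ?thesis by (simp add: algebra_simps)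
  qed
  ultimately have "F x - (2 * harm m - 1 / of_nat m) \<in> \<P> 1"
    by (metis ideal_commute ideal_trans)
  then have "of_nat p * (F x - (2 * harm m - 1 / of_nat m)) \<in> \<P> (Suc 1)"
    by (simp only: ideal_p_mult_iff)
  then have "Q + of_nat p * (F x - (2 * harm m - 1 / of_nat m)) \<in> \<P> 2"
    using Q by (auto simp: numeral_2_eq_2)
  moreover have "x\<^sup>2 * step_sum x = of_nat p * F x - 1 + Q"
  proof -
    have "x\<^sup>2 * step_sum x = of_nat p * F x - (\<Sum>k<p - 1. (- 1) ^ k * x\<^sup>2 * sqprod k x)"
      unfolding F_def step_sum_def sum_distrib_left sum_subtractf[symmetric]
      by (intro sum.cong refl) (simp add: algebra_simps del: of_nat_Suc)
    then show ?thesis unfolding sqprod_telescope Q_def by simp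
  qed
  ultimately show ?thesis unfolding x_def by (simp add: algebra_simps)
qed

text \<open>The contributions of the steps at multiples of 3, accumulated up to \<open>m\<close>, when \<open>p = 3\<close>.\<close>

definition defect :: "nat \<Rightarrow> rat" where
  "defect m = (if p = 3 then 9 * of_nat ((m div 3) * (m div 3 + 1)) else 0)"

text \<open>Induction on \<open>m\<close>. At a unit \<open>x = m + 1\<close> the quadratic
  expression in \<open>harm\<close> grows by
  \<open>2 * p / x * (p * (2 * harm (m + 1) - 1 / x) - 1)\<close>, which is what
  \<open>V_step\<close> and \<open>step_sum_unit\<close> give modulo \<open>p ^ 3\<close>. At
  multiples of \<open>p\<close> only \<open>defect\<close> can change.\<close>

lemma V_harm:
  "V (p - 1) (of_nat m) - (1 - 2 * of_nat p * harm m + 2 * (of_nat p)\<^sup>2 * (harm m)\<^sup>2 + defect m) \<in> \<P> 3"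
proof (induction m)
  case 0
  have "defect 0 = 0" by (simp add: defect_def)
  then show ?case by (simp add: V_zero)
next
  case (Suc m)
  define x :: rat where "x = of_nat (Suc m)"
  let ?f = "\<lambda>h. 1 - 2 * of_nat p * h + 2 * (of_nat p)\<^sup>2 * h\<^sup>2 :: rat"
  have xm: "x - 1 = of_nat m" by (simp add: x_def)
  have V: "V (p - 1) x - V (p - 1) (of_nat m) - 2 * of_nat p * x * step_sum x \<in> \<P> 3"
    using V_step[of x] unfolding xm by (simp add: x_def del: of_nat_Suc)
  have "2 * of_nat p * x * step_sum x - (?f (harm (Suc m)) + defect (Suc m) - (?f (harm m) + defect m)) \<in> \<P> 3"
  proof (cases "p dvd Suc m")
    case False
    have "x \<noteq> 0" by (simp add: x_def del: of_nat_Suc)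
    have "Suc m div 3 = m div 3" if "p = 3"
      using False that by (simp add: div_Suc dvd_eq_mod_eq_0)
    then have d: "defect (Suc m) = defect m" by (simp add: defect_def)
    have h: "harm m = harm (Suc m) - 1 / x"
      using False by (simp add: harm_Suc x_def del: of_nat_Suc)
    define R where "R = x\<^sup>2 * step_sum x + 1 - of_nat p * (2 * harm (Suc m) - 1 / x)"
    have "R \<in> \<P> 2" unfolding R_def x_def by (rule step_sum_unit[OF False])
    then have "of_nat p * R \<in> \<P> (Suc 2)" by (simp only: ideal_p_mult_iff)
    then have "2 * (of_nat p * R) / of_nat (Suc m) \<in> \<P> (Suc 2)"
      using False by (intro ideal_divide_of_nat) (rule ideal_mult_left[OF Zp_numeral])
    also have "2 * (of_nat p * R) / of_nat (Suc m)
      = 2 * of_nat p * x * step_sum x - (?f (harm (Suc m)) + defect (Suc m) - (?f (harm m) + defect m))"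
      unfolding d h R_def x_def[symmetric] using \<open>x \<noteq> 0\<close>
      by (simp add: field_simps power2_eq_square)
    finally show ?thesis by (simp add: numeral_3_eq_3 numeral_2_eq_2)
  next
    case True
    have h: "harm (Suc m) = harm m" using True by (simp add: harm_Suc)
    have x: "x \<in> \<P> 1" unfolding x_def using True by (intro of_nat_ideal) simp
    have three: "(1 + 1 + 1 :: nat) = 3" by simp
    show ?thesis
    proof (cases "p = 3")
      case False
      then have "p > 3" using p_ge_3 by simp
      then have "step_sum x \<in> \<P> 1"
        using ideal_diff[OF step_sum_cong_dvd[OF x] sum_inverse_squares] by simp
      \<comment> \<open>The factors \<open>p\<close>, \<open>x\<close> and \<open>step_sum x\<close>
        contribute one power of \<open>p\<close> each.\<close>
      then have "2 * of_nat p * x * step_sum x \<in> \<P> (1 + 1 + 1)"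
        using x ideal_p_power[of 2 1] by (intro ideal_mult) (auto simp: mult.commute)
      then have "2 * of_nat p * x * step_sum x \<in> \<P> 3" by (simp only: three)
      moreover have "defect (Suc m) = defect m" by (simp add: defect_def False)
      ultimately show ?thesis by (simp add: h)
    next
      case p3: True
      obtain t where t: "Suc m = 3 * t" using True p3 by auto
      have div: "Suc m div 3 = t" "m div 3 = t - 1" "t > 0" using t by auto
      \<comment> \<open>For \<open>p = 3\<close> the inverse squares add up to
        \<open>1 + 1 / 4\<close>, which is \<open>- 1\<close> modulo 3, so \<open>step_sum x\<close>
        is 1 modulo 3.\<close>
      have "(\<Sum>k<p - 1. 1 / (of_nat (Suc k))\<^sup>2) = (5 / 4 :: rat)"
        unfolding p3 by (simp add: numeral_2_eq_2)
      then have "step_sum x + 5 / 4 \<in> \<P> 1" using step_sum_cong_dvd[OF x] by (simp only:)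
      moreover have "\<not> p dvd 4" by (simp add: p3)
      then have "of_nat p ^ 1 * (3 / of_nat 4) \<in> \<P> 1"
        by (intro ideal_p_power Zp_divide_of_nat Zp_numeral)
      ultimately have "step_sum x + 5 / 4 - of_nat p ^ 1 * (3 / of_nat 4) \<in> \<P> 1" by (rule ideal_diff)
      also have "step_sum x + 5 / 4 - of_nat p ^ 1 * (3 / of_nat 4) = step_sum x - 1"
        by (simp add: p3)
      finally have "step_sum x - 1 \<in> \<P> 1" .
      moreover have "2 * of_nat p * x \<in> \<P> (1 + 1)"
        using x ideal_p_power[of 2 1] by (intro ideal_mult) (auto simp: mult.commute)
      ultimately have "2 * of_nat p * x * (step_sum x - 1) \<in> \<P> (1 + 1 + 1)"
        by (metis ideal_mult)
      then have "2 * of_nat p * x * (step_sum x - 1) \<in> \<P> 3" by (simp only: three)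
      \<comment> \<open>With \<open>x = 3 * t\<close>, both sides are
        \<open>9 * (t * (t + 1) - (t - 1) * t) = 18 * t\<close>.\<close>
      moreover have "defect (Suc m) - defect m = 2 * of_nat p * x"
        unfolding defect_def div x_def t using p3 \<open>t > 0\<close> by (simp add: of_nat_diff algebra_simps)
      ultimately show ?thesis by (simp add: h algebra_simps)
    qed
  qed
  from ideal_add[OF ideal_add[OF V this] Suc.IH] show ?case
    unfolding x_def[symmetric] by (simp add: algebra_simps)
qed

subsection \<open>The Bernoulli quotient\<close>

lemma of_int_ideal_iff: "of_int a \<in> \<P> r \<longleftrightarrow> int p ^ r dvd a"
proof
  assume "of_int a \<in> \<P> r"
  then obtain c where c: "c \<in> Zp p" "of_int a = of_nat p ^ r * c" by (auto simp: ideal_def)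
  obtain u v where uv: "coprime v (int p)" "c = of_int u / of_int v"
    using c(1) unfolding Zp_iff by (elim exE conjE)
  have "v \<noteq> 0" using uv p_ge_3 by auto
  then have "of_int (a * v) = (of_int (int p ^ r * u) :: rat)"
    using c(2) uv(2) by (simp add: field_simps)
  then have "int p ^ r dvd a * v" by (simp only: of_int_eq_iff dvd_triv_left)
  moreover have "coprime (int p ^ r) v" using uv(1) by (simp add: coprime_commute)
  ultimately show "int p ^ r dvd a" by (simp add: coprime_dvd_mult_left_iff)
qed (rule of_int_ideal)

lemma of_nat_diff_ideal_iff: "of_nat a - of_nat b \<in> \<P> r \<longleftrightarrow> [a = b] (mod p ^ r)"
  using of_int_ideal_iff[of "int a - int b" r]
  by (simp add: cong_int_iff[symmetric] cong_iff_dvd_diff)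

lemma rat_denominator_power:
  obtains s where "of_nat p ^ s * (c :: rat) \<in> Zp p"
proof -
  obtain u v where uv: "quotient_of c = (u, v)" by force
  have v: "v > 0" "c = of_int u / of_int v"
    using quotient_of_denom_pos[OF uv] quotient_of_div[OF uv] by auto
  obtain s w where w: "v = int p ^ s * w" "\<not> int p dvd w"
    using multiplicity_decompose'[of v "int p"] v(1) prime_p
    by (metis int_ops(2) nat_int_comparison(1) not_prime_unit of_nat_power order_less_irrefl prime_nat_int_transfer)
  have "coprime w (int p)"
    using w(2) prime_p by (metis coprime_commute prime_imp_coprime prime_nat_int_transfer)
  moreover have "of_nat p ^ s * c = of_int u / of_int w"
    using v w p_ge_3 by (simp add: field_simps)
  ultimately have "of_nat p ^ s * c \<in> Zp p" unfolding Zp_iff by blast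
  then show ?thesis by (rule that)
qed

text \<open>
  The denominators of the coefficients only cost a fixed power of \<open>p\<close>, so nothing about the
  denominators of Bernoulli numbers is needed.
\<close>

lemma rat_polynomial_cong:
  fixes c :: "nat \<Rightarrow> rat" and e :: "nat \<Rightarrow> nat"
  assumes "finite K"
  obtains s where "\<And>x y r. x \<in> Zp p \<Longrightarrow> y \<in> Zp p \<Longrightarrow> x - y \<in> \<P> (s + r) \<Longrightarrow>
    (\<Sum>k\<in>K. c k * x ^ e k) - (\<Sum>k\<in>K. c k * y ^ e k) \<in> \<P> r"
proof -
  have "\<exists>s. \<forall>x y r. x \<in> Zp p \<longrightarrow> y \<in> Zp p \<longrightarrow> x - y \<in> \<P> (s + r) \<longrightarrow>
    (\<Sum>k\<in>K. c k * x ^ e k) - (\<Sum>k\<in>K. c k * y ^ e k) \<in> \<P> r"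
    using assms
  proof induction
    case (insert k K)
    then obtain s where s: "\<And>x y r. x \<in> Zp p \<Longrightarrow> y \<in> Zp p \<Longrightarrow> x - y \<in> \<P> (s + r) \<Longrightarrow>
      (\<Sum>k\<in>K. c k * x ^ e k) - (\<Sum>k\<in>K. c k * y ^ e k) \<in> \<P> r" by blast
    obtain t where t: "of_nat p ^ t * c k \<in> Zp p" by (rule rat_denominator_power)
    show ?case
    proof (intro exI[of _ "t + s"] allI impI)
      fix x y :: rat and r
      assume xy: "x \<in> Zp p" "y \<in> Zp p" "x - y \<in> \<P> (t + s + r)"
      have "x - y \<in> \<P> (s + r)" by (rule ideal_mono[OF xy(3)]) simp
      then have 1: "(\<Sum>k\<in>K. c k * x ^ e k) - (\<Sum>k\<in>K. c k * y ^ e k) \<in> \<P> r"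
        by (rule s[OF xy(1,2)])
      have "x - y \<in> \<P> (t + r)" by (rule ideal_mono[OF xy(3)]) simp
      then have "x ^ e k - y ^ e k \<in> \<P> (t + r)" by (rule ideal_diff_power) (use xy in auto)
      from ideal_mult_left[OF t this]
      have "of_nat p ^ t * (c k * x ^ e k - c k * y ^ e k) \<in> \<P> (t + r)"
        by (simp add: algebra_simps)
      then have "c k * x ^ e k - c k * y ^ e k \<in> \<P> r" by (simp only: ideal_cancel)
      from ideal_diff_add[OF this 1]
      show "(\<Sum>k\<in>insert k K. c k * x ^ e k) - (\<Sum>k\<in>insert k K. c k * y ^ e k) \<in> \<P> r"
        using insert.hyps by simp
    qed
  qed auto
  then show ?thesis using that by blast
qed

lemma T_of_nat: "T p (of_nat m) = (\<Sum>j=1..m. of_nat j ^ (p\<^sup>2 * (p - 1) - 1))"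
proof -
  have "even (p\<^sup>2 * (p - 1))" "0 < p\<^sup>2 * (p - 1)" using odd_p p_ge_3 by auto
  then show ?thesis
    unfolding T_def by (subst bernoulli_poly_neg_of_nat) auto
qed

text \<open>The number \<open>n = p ^ 2 * (p - 1)\<close> is the totient of \<open>p ^ 3\<close>, so
  \<open>j ^ (n - 1)\<close> inverts a unit \<open>j\<close>; a multiple of \<open>p\<close> is
  raised to an exponent of at least 2.\<close>

lemma T_of_nat_harm: "T p (of_nat m) - harm m \<in> \<P> 2"
  unfolding T_of_nat harm_def
proof (rule ideal_diff_sum)
  fix j assume "j \<in> {1..m}"
  define n where "n = p\<^sup>2 * (p - 1)"
  have "3 * 1 \<le> n" unfolding n_def using p_ge_3
    by (intro mult_mono) (auto simp: power2_eq_square intro: order.trans[of _ "p * 1"])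
  then have n: "n \<ge> 3" by simp
  show "of_nat j ^ (p\<^sup>2 * (p - 1) - 1) - (if p dvd j then 0 else 1 / of_nat j) \<in> \<P> 2"
    unfolding n_def[symmetric]
  proof (cases "p dvd j")
    case True
    have "p ^ 2 dvd j ^ (n - 1)"
      using n by (intro dvd_trans[OF dvd_power_same[OF True]] le_imp_power_dvd) simp
    then show "of_nat j ^ (n - 1) - (if p dvd j then 0 else 1 / of_nat j) \<in> \<P> 2"
      using of_nat_ideal[of 2 "j ^ (n - 1)"] True by simp
  next
    case False
    then have "j \<noteq> 0" by (metis dvd_0_right)
    have "coprime j (p ^ 3)"
      using prime_imp_coprime[OF prime_p False] by (simp add: coprime_commute)
    from euler_theorem[OF this] have "[j ^ n = 1] (mod p ^ 3)"
      using prime_p by (simp add: totient_prime_power n_def)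
    then have "of_nat (j ^ n) - of_nat 1 \<in> \<P> 3" by (rule ideal_of_nat_diff)
    then have "(of_nat (j ^ n) - of_nat 1) / of_nat j \<in> \<P> 2"
      using False by (intro ideal_divide_of_nat) (rule ideal_mono[of _ 3], auto)
    also have "(of_nat (j ^ n) - of_nat 1) / of_nat j = of_nat j ^ (n - 1) - (1 / of_nat j :: rat)"
      using \<open>j \<noteq> 0\<close> n by (cases n) (auto simp: field_simps)
    finally show "of_nat j ^ (n - 1) - (if p dvd j then 0 else 1 / of_nat j) \<in> \<P> 2"
      using False by simp
  qed
qed

text \<open>\<open>T p\<close> is a polynomial. For a natural \<open>k\<close> so close to
  \<open>x\<close> that the denominators of the coefficients are absorbed, \<open>T p x\<close>
  agrees with \<open>harm k\<close>. Modulo \<open>p ^ 2\<close>, \<open>harm\<close> has period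
  \<open>p ^ 2\<close>, so \<open>k\<close> can be exchanged for \<open>m\<close>.\<close>

lemma T_harm:
  assumes "x \<in> Zp p" "x - of_nat m \<in> \<P> 2"
  shows "T p x - harm m \<in> \<P> 2"
proof -
  define n where "n = p\<^sup>2 * (p - 1)"
  obtain s where s: "\<And>x y r. x \<in> Zp p \<Longrightarrow> y \<in> Zp p \<Longrightarrow> x - y \<in> \<P> (s + r) \<Longrightarrow>
    (\<Sum>k\<in>{..n}. (of_nat (n choose k) * bernoulli k / of_nat n) * x ^ (n - k))
    - (\<Sum>k\<in>{..n}. (of_nat (n choose k) * bernoulli k / of_nat n) * y ^ (n - k)) \<in> \<P> r"
    by (rule rat_polynomial_cong[where K = "{..n}" and e = "\<lambda>k. n - k"
          and c = "\<lambda>k. of_nat (n choose k) * bernoulli k / of_nat n"]) auto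
  obtain k where k: "x - of_nat k \<in> \<P> (s + 2)" using assms(1) by (rule Zp_approx)
  have T: "T p y = (\<Sum>k\<in>{..n}. (of_nat (n choose k) * bernoulli k / of_nat n) * (- y) ^ (n - k))
     - bernoulli n / of_nat n" for y
    unfolding T_def n_def[symmetric] bernoulli_poly_def diff_divide_distrib sum_divide_distrib by simp
  have "T p x - T p (of_nat k) \<in> \<P> 2"
    using s[of "- x" "- of_nat k" 2] k assms(1) unfolding T by (auto simp: ideal_commute)
  moreover have "T p (of_nat k) - harm k \<in> \<P> 2" by (rule T_of_nat_harm)
  moreover have "harm k - harm m \<in> \<P> 2"
  proof (rule harm_cong)
    have "x - of_nat k \<in> \<P> 2" by (rule ideal_mono[OF k]) simp
    then have "of_nat k - of_nat m \<in> \<P> 2" using assms(2) ideal_commute ideal_trans by metis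
    then show "[k = m] (mod p\<^sup>2)" by (simp only: of_nat_diff_ideal_iff)
  qed simp
  ultimately show ?thesis using ideal_trans by blast
qed

lemma T_Zp: "x \<in> Zp p \<Longrightarrow> T p x \<in> Zp p"
proof -
  assume x: "x \<in> Zp p"
  obtain m where "x - of_nat m \<in> \<P> 2" using x by (rule Zp_approx)
  then have "T p x - harm m \<in> Zp p" using T_harm[OF x] ideal_subset_Zp by blast
  from Zp_add[OF this harm_Zp[of m]] show ?thesis by simp
qed

subsection \<open>Euler quotients and harmonic sums\<close>

lemma prod_one_plus_ideal:
  assumes "\<And>i. i \<in> A \<Longrightarrow> u i \<in> Zp p"
  shows "(\<Prod>i\<in>A. 1 + of_nat p ^ r * u i) - (1 + of_nat p ^ r * (\<Sum>i\<in>A. u i)) \<in> \<P> (r + r)"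
  using assms
proof (induction A rule: infinite_finite_induct)
  case (insert a A)
  let ?N = "of_nat p ^ r :: rat"
  have "(1 + ?N * u a) * ((\<Prod>i\<in>A. 1 + ?N * u i) - (1 + ?N * (\<Sum>i\<in>A. u i))) \<in> \<P> (r + r)"
    using insert by (intro ideal_mult_left) auto
  moreover have "?N * u a * (?N * (\<Sum>i\<in>A. u i)) \<in> \<P> (r + r)"
    using insert by (intro ideal_mult[OF ideal_p_power ideal_p_power] Zp_sum) auto
  ultimately have "(1 + ?N * u a) * ((\<Prod>i\<in>A. 1 + ?N * u i) - (1 + ?N * (\<Sum>i\<in>A. u i)))
    + ?N * u a * (?N * (\<Sum>i\<in>A. u i)) \<in> \<P> (r + r)" by (rule ideal_add)
  then show ?case using insert.hyps by (simp add: algebra_simps)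
qed auto

lemma harm_units: "m < p ^ r \<Longrightarrow> harm m = (\<Sum>a\<in>{a \<in> units r. a \<le> m}. 1 / of_nat a)"
proof -
  assume m: "m < p ^ r"
  have "0 < j" if "\<not> p dvd j" for j
    using that by (cases j) auto
  then have eq: "{a \<in> units r. a \<le> m} = {j \<in> {1..m}. \<not> p dvd j}"
    using m by (auto simp: units_def Suc_le_eq)
  show ?thesis
    unfolding eq sum.inter_filter[OF finite_atLeastAtMost] harm_def by (intro sum.cong) auto
qed

text \<open>\<open>d * a div p ^ r\<close> counts the \<open>i\<close> in \<open>{1..<d}\<close>
  with \<open>i * p ^ r \<le> d * a\<close>. After exchanging the sums, this condition selects the
  units beyond \<open>i * p ^ r div d\<close>.\<close>

lemma sum_quotients:
  assumes r: "0 < r" and d: "\<not> p dvd d"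
  shows "(\<Sum>a\<in>units r. of_nat (d * a div p ^ r) / of_nat a)
    = (\<Sum>i=1..<d. harm (p ^ r - 1) - harm (i * p ^ r div d))"
proof -
  let ?N = "p ^ r"
  have N: "?N > 0" using p_ge_3 by simp
  have d0: "d > 0" using d by (metis dvd_0_right gr0I)
  have "(\<Sum>a\<in>units r. of_nat (d * a div ?N) / of_nat a)
    = (\<Sum>a\<in>units r. \<Sum>i=1..<d. if i * ?N \<le> d * a then 1 / of_nat a else 0 :: rat)"
  proof (intro sum.cong refl)
    fix a assume a: "a \<in> units r"
    have "d * a div ?N < d"
      using a d0 N by (simp add: units_def div_less_iff_less_mult)
    then have "{i \<in> {1..<d}. i * ?N \<le> d * a} = {1..d * a div ?N}"
      unfolding less_eq_div_iff_mult_less_eq[OF N, symmetric] by auto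
    then have "(\<Sum>i=1..<d. if i * ?N \<le> d * a then 1 / of_nat a else 0 :: rat)
      = (\<Sum>i\<in>{1..d * a div ?N}. 1 / of_nat a)"
      by (subst sum.inter_filter[symmetric]) simp_all
    then show "of_nat (d * a div ?N) / of_nat a
      = (\<Sum>i=1..<d. if i * ?N \<le> d * a then 1 / of_nat a else 0 :: rat)" by simp
  qed
  also have "\<dots> = (\<Sum>i=1..<d. \<Sum>a\<in>units r. if i * ?N \<le> d * a then 1 / of_nat a else 0)"
    by (rule sum.swap)
  also have "\<dots> = (\<Sum>i=1..<d. harm (?N - 1) - harm (i * ?N div d))"
  proof (intro sum.cong refl)
    fix i assume i: "i \<in> {1..<d}"
    have lt: "i * ?N div d < ?N"
      using i N by (simp add: div_less_iff_less_mult)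
    have le: "a \<le> i * ?N div d \<longleftrightarrow> \<not> i * ?N \<le> d * a" if "a \<in> units r" for a
    proof -
      have "d * a \<noteq> i * ?N"
      \<comment> \<open>Equality would force \<open>p\<close> to divide \<open>d * a\<close>; hence
        the strict and the weak inequality agree.\<close>
      proof
        assume "d * a = i * ?N"
        then have "p dvd d * a" using r by (simp add: dvd_power)
        then show False using that d prime_p by (simp add: units_def prime_dvd_mult_iff)
      qed
      then show ?thesis using d0 by (auto simp: less_eq_div_iff_mult_less_eq mult.commute)
    qed
    have "harm (?N - 1) = (\<Sum>a\<in>units r. 1 / of_nat a)"
      using N by (subst harm_units[of _ r]) (auto simp: units_def intro!: sum.cong)
    moreover have "harm (i * ?N div d) = (\<Sum>a\<in>units r. if a \<le> i * ?N div d then 1 / of_nat a else 0)"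
      using lt by (simp add: harm_units sum.inter_filter)
    ultimately have "harm (?N - 1) - harm (i * ?N div d)
      = (\<Sum>a\<in>units r. 1 / of_nat a - (if a \<le> i * ?N div d then 1 / of_nat a else 0))"
      by (simp add: sum_subtractf)
    also have "\<dots> = (\<Sum>a\<in>units r. if i * ?N \<le> d * a then 1 / of_nat a else 0)"
      by (intro sum.cong refl) (simp add: le)
    finally show "(\<Sum>a\<in>units r. if i * ?N \<le> d * a then 1 / of_nat a else 0) = harm (?N - 1) - harm (i * ?N div d)"
      by (rule sym)
  qed
  finally show ?thesis .
qed

lemma fermat_quotient:
  assumes r: "0 < r" and d: "\<not> p dvd d"
  shows "of_nat d * (of_nat d ^ (p ^ (r - 1) * (p - 1)) - 1)
    + of_nat p ^ r * (\<Sum>i=1..<d. harm (i * p ^ r div d)) \<in> \<P> (r + r)"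
proof -
  let ?N = "p ^ r"
  let ?f = "\<lambda>a. d * a div ?N" and ?g = "\<lambda>a. d * a mod ?N"
  have g: "\<not> p dvd ?g a" "a \<noteq> 0" "?g a \<noteq> 0" "\<not> p dvd d * a" if "a \<in> units r" for a
  proof -
    have "?g a \<in> units r" using bij_betwE[OF bij_units[OF r d]] that by blast
    then show "\<not> p dvd ?g a" by (simp add: units_def)
    then show "?g a \<noteq> 0" by (metis dvd_0_right)
    show "a \<noteq> 0" using that by (cases "a = 0") (simp_all add: units_def)
    show "\<not> p dvd d * a" using that d prime_p by (simp add: units_def prime_dvd_mult_iff)
  qed
  have "of_nat d ^ card (units r) * (\<Prod>a\<in>units r. of_nat a) = (\<Prod>a\<in>units r. of_nat (d * a) :: rat)"
    by (simp add: prod.distrib)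
  also have "\<dots> = (\<Prod>a\<in>units r. of_nat (?g a) * (1 + of_nat p ^ r * (of_nat (?f a) / of_nat (?g a))))"
  proof (intro prod.cong refl)
    fix a assume a: "a \<in> units r"
    have "(of_nat (d * a) :: rat) = of_nat (?f a * ?N + ?g a)" by (simp only: div_mult_mod_eq)
    then show "(of_nat (d * a) :: rat) = of_nat (?g a) * (1 + of_nat p ^ r * (of_nat (?f a) / of_nat (?g a)))"
      using g(3)[OF a] by (simp only: of_nat_add of_nat_mult of_nat_power) (simp add: field_simps)
  qed
  \<comment> \<open>The remainders run through the units once more, so their product cancels against
    that of the \<open>a\<close>.\<close>
  also have "\<dots> = (\<Prod>a\<in>units r. of_nat a) * (\<Prod>a\<in>units r. 1 + of_nat p ^ r * (of_nat (?f a) / of_nat (?g a)))"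
    unfolding prod.distrib using prod.reindex_bij_betw[OF bij_units[OF r d], of "of_nat :: nat \<Rightarrow> rat"] by simp
  finally have "of_nat d ^ card (units r) = (\<Prod>a\<in>units r. 1 + of_nat p ^ r * (of_nat (?f a) / of_nat (?g a)) :: rat)"
    using g(2) by simp
  moreover have "(\<Prod>a\<in>units r. 1 + of_nat p ^ r * (of_nat (?f a) / of_nat (?g a)))
    - (1 + of_nat p ^ r * (\<Sum>a\<in>units r. of_nat (?f a) / of_nat (?g a))) \<in> \<P> (r + r)"
    by (intro prod_one_plus_ideal Zp_divide_of_nat Zp_of_nat g)
  ultimately have 1: "of_nat d ^ card (units r)
    - (1 + of_nat p ^ r * (\<Sum>a\<in>units r. of_nat (?f a) / of_nat (?g a))) \<in> \<P> (r + r)" by (simp only:)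
  \<comment> \<open>The sum is multiplied by \<open>p ^ r\<close>, so its terms matter only modulo
    \<open>p ^ r\<close>. With \<open>d * a\<close> in place of the remainder,
    \<open>sum_quotients\<close> applies.\<close>
  have "(\<Sum>a\<in>units r. of_nat (?f a) / of_nat (?g a)) - (\<Sum>a\<in>units r. of_nat (?f a) / of_nat (d * a)) \<in> \<P> r"
  proof (rule ideal_diff_sum)
    fix a assume a: "a \<in> units r"
    have "1 / of_nat (?g a) - 1 / of_nat (d * a) \<in> \<P> r"
      by (intro ideal_inverse_diff ideal_of_nat_diff g a) (simp add: cong_def)
    from ideal_mult_left[OF Zp_of_nat this]
    show "of_nat (?f a) / of_nat (?g a) - of_nat (?f a) / of_nat (d * a) \<in> \<P> r"
      by (simp add: right_diff_distrib)
  qed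
  then have "of_nat p ^ r * ((\<Sum>a\<in>units r. of_nat (?f a) / of_nat (?g a))
     - (\<Sum>a\<in>units r. of_nat (?f a) / of_nat (d * a))) \<in> \<P> (r + r)"
    by (simp only: ideal_cancel)
  from ideal_mult_left[OF Zp_of_nat[of d] ideal_add[OF 1 this]]
  have 2: "of_nat d * (of_nat d ^ card (units r) - 1)
    - of_nat p ^ r * (of_nat d * (\<Sum>a\<in>units r. of_nat (?f a) / of_nat (d * a))) \<in> \<P> (r + r)"
    by (simp add: algebra_simps)
  have "d \<noteq> 0" using d by (metis dvd_0_right)
  then have "of_nat d * (\<Sum>a\<in>units r. of_nat (?f a) / of_nat (d * a)) = (\<Sum>a\<in>units r. of_nat (?f a) / of_nat a :: rat)"
    by (simp add: sum_distrib_left)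
  also have "\<dots> = of_nat (d - 1) * harm (?N - 1) - (\<Sum>i=1..<d. harm (i * ?N div d))"
    unfolding sum_quotients[OF r d] sum_subtractf by simp
  finally have "of_nat d * (\<Sum>a\<in>units r. of_nat (?f a) / of_nat (d * a))
    = of_nat (d - 1) * harm (?N - 1) - (\<Sum>i=1..<d. harm (i * ?N div d))" .
  from 2[unfolded this] have 3: "of_nat d * (of_nat d ^ card (units r) - 1)
    + of_nat p ^ r * (\<Sum>i=1..<d. harm (i * ?N div d)) - of_nat p ^ r * (of_nat (d - 1) * harm (?N - 1)) \<in> \<P> (r + r)"
    by (simp add: algebra_simps del: of_nat_diff)
  have "harm (?N - 1) \<in> \<P> r"
    using harm_reflect[OF r, of 0] p_ge_3 by simp
  then have "of_nat p ^ r * (of_nat (d - 1) * harm (?N - 1)) \<in> \<P> (r + r)"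
    by (simp only: ideal_cancel ideal_mult_left Zp_of_nat)
  from ideal_add[OF 3 this] show ?thesis
    unfolding card_units[OF r] by simp
qed


subsection \<open>The congruences modulo the cube of p\<close>

text \<open>The difference factors as \<open>p * (h - h') * (2 * p * (h + h') - 2)\<close>; thus
  \<open>T p x\<close> is needed only modulo \<open>p ^ 2\<close>.\<close>

lemma V_T_step:
  assumes "h - h' \<in> \<P> 2" "h \<in> Zp p" "h' \<in> Zp p"
  shows "(1 - 2 * of_nat p * h + 2 * (of_nat p)\<^sup>2 * h\<^sup>2)
    - (1 - 2 * of_nat p * h' + 2 * (of_nat p)\<^sup>2 * h'\<^sup>2) \<in> \<P> 3"
proof -
  have "of_nat p * (h - h') \<in> \<P> (Suc 2)"
    using assms(1) by (simp only: ideal_p_mult_iff)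
  then have "of_nat p * (h - h') * (2 * of_nat p * (h + h') - 2) \<in> \<P> (Suc 2)"
    by (rule ideal_mult_right) (use assms in auto)
  then show ?thesis
    by (simp add: algebra_simps power2_eq_square numeral_3_eq_3 flip: Suc_1)
qed

text \<open>\<open>V_harm\<close> treats a natural \<open>m\<close> congruent to \<open>x\<close>
  modulo \<open>p ^ 3\<close>; \<open>V_cong\<close> and \<open>T_harm\<close> carry the result over
  to \<open>x\<close>. Outside the exceptional classes the defect vanishes modulo
  \<open>p ^ 3\<close>.\<close>

lemma V_T_congruence:
  assumes x: "x \<in> Zp p" and "\<not> exceptional p x"
  shows "cong_Zp p 3 (V (p - 1) x) (1 - 2 * of_nat p * T p x + 2 * (of_nat p)\<^sup>2 * (T p x)\<^sup>2)"
proof -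
  obtain m where m: "x - of_nat m \<in> \<P> 3" using x by (rule Zp_approx)
  then have m2: "x - of_nat m \<in> \<P> 2" by (rule ideal_mono) simp
  have defect: "defect m \<in> \<P> 3"
  proof (cases "p = 3")
    case True
    have ne: "m mod 9 \<noteq> j" if "j \<in> {3, 4, 5}" for j
    proof
      assume "m mod 9 = j"
      then have "[m = j] (mod p ^ 2)" using that by (auto simp: cong_def True)
      then have "x - of_nat j \<in> \<P> 2" using m2 ideal_of_nat_diff ideal_trans by blast
      then have "cong_Zp p 2 x (of_nat j)" using x by (simp add: cong_Zp_iff)
      then show False using assms(2) that by (auto simp: exceptional_def True)
    qed
    \<comment> \<open>With \<open>q = m div 3\<close>, the defect \<open>9 * q * (q + 1)\<close> is
      a multiple of 27 unless \<open>q\<close> is 1 modulo 3, that is, unless \<open>m mod 9\<close>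
      is 3, 4 or 5.\<close>
    have "m mod 9 = 3 * (m div 3 mod 3) + m mod 3"
      using mod_mult2_eq[of m 3 3] by simp
    moreover have "m mod 3 = 0 \<or> m mod 3 = 1 \<or> m mod 3 = 2" by linarith
    moreover have "m mod 9 \<noteq> 3" "m mod 9 \<noteq> 4" "m mod 9 \<noteq> 5" by (simp_all add: ne)
    ultimately have "(m div 3) mod 3 \<noteq> 1" by (elim disjE; simp; linarith)
    then have "(m div 3) mod 3 = 0 \<or> (m div 3 + 1) mod 3 = 0" by presburger
    then have "3 dvd m div 3 \<or> 3 dvd m div 3 + 1" by (simp only: dvd_eq_mod_eq_0)
    then have "3 dvd (m div 3) * (m div 3 + 1)" by (blast intro: dvd_mult dvd_mult2)
    then have "9 * 3 dvd 9 * ((m div 3) * (m div 3 + 1))" by (rule mult_dvd_mono[OF dvd_refl])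
    then have "p ^ 3 dvd 9 * ((m div 3) * (m div 3 + 1))" by (simp add: True)
    moreover have "defect m = of_nat (9 * ((m div 3) * (m div 3 + 1)))"
      unfolding defect_def by (simp add: True)
    ultimately show ?thesis by (simp only: of_nat_ideal)
  qed (simp add: defect_def)
  have "V (p - 1) x - V (p - 1) (of_nat m) \<in> \<P> 3"
    by (rule V_cong[OF x _ m]) simp
  from ideal_trans[OF this V_harm]
  have "V (p - 1) x - (1 - 2 * of_nat p * harm m + 2 * (of_nat p)\<^sup>2 * (harm m)\<^sup>2 + defect m) \<in> \<P> 3" .
  from ideal_add[OF this defect]
  have "V (p - 1) x - (1 - 2 * of_nat p * harm m + 2 * (of_nat p)\<^sup>2 * (harm m)\<^sup>2) \<in> \<P> 3"
    by (simp add: algebra_simps)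
  moreover have "harm m - T p x \<in> \<P> 2"
    using T_harm[OF x m2] by (simp only: ideal_commute)
  from V_T_step[OF this harm_Zp T_Zp[OF x]]
  have "(1 - 2 * of_nat p * harm m + 2 * (of_nat p)\<^sup>2 * (harm m)\<^sup>2)
    - (1 - 2 * of_nat p * T p x + 2 * (of_nat p)\<^sup>2 * (T p x)\<^sup>2) \<in> \<P> 3" .
  ultimately have "V (p - 1) x - (1 - 2 * of_nat p * T p x + 2 * (of_nat p)\<^sup>2 * (T p x)\<^sup>2) \<in> \<P> 3"
    by (rule ideal_trans)
  then show ?thesis
    using V_Zp[OF x] T_Zp[OF x] by (auto simp: cong_Zp_iff)
qed

text \<open>For \<open>3 \<le> k < p\<close> the binomial coefficient supplies one factor
  \<open>p\<close> and \<open>y ^ k\<close> at least three more; the term \<open>y ^ p\<close>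
  suffices alone because \<open>p \<ge> 5\<close>.\<close>

lemma one_plus_power_p:
  assumes "p > 3" "y \<in> \<P> 1"
  shows "(1 + y) ^ p - (1 + of_nat p * y + of_nat (p choose 2) * y\<^sup>2) \<in> \<P> 4"
proof -
  have p5: "p \<ge> 5"
    using assms(1) odd_p by (cases "p = 4") auto
  have yk: "y ^ k \<in> \<P> k" for k
  proof (induction k)
    case (Suc k)
    from ideal_mult[OF assms(2) Suc.IH] show ?case by simp
  qed (simp add: ideal_def)
  have "(1 + y) ^ p = (\<Sum>k\<le>p. of_nat (p choose k) * y ^ k)"
    using binomial_ring[of y 1 p] by (simp add: add.commute)
  also have "{..p} = {..2} \<union> {3..p}" using p5 by auto
  also have "(\<Sum>k\<in>{..2} \<union> {3..p}. of_nat (p choose k) * y ^ k)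
    = (\<Sum>k\<le>2. of_nat (p choose k) * y ^ k) + (\<Sum>k=3..p. of_nat (p choose k) * y ^ k)"
    by (rule sum.union_disjoint) auto
  also have "(\<Sum>k\<le>2. of_nat (p choose k) * y ^ k) = 1 + of_nat p * y + of_nat (p choose 2) * y\<^sup>2"
    by (simp add: numeral_2_eq_2)
  finally have "(1 + y) ^ p - (1 + of_nat p * y + of_nat (p choose 2) * y\<^sup>2)
    = (\<Sum>k=3..p. of_nat (p choose k) * y ^ k)" by simp
  also have "\<dots> \<in> \<P> 4"
  proof (rule ideal_sum)
    fix k assume k: "k \<in> {3..p}"
    show "of_nat (p choose k) * y ^ k \<in> \<P> 4"
    proof (cases "k = p")
      case True
      then show ?thesis using ideal_mono[OF yk[of p], of 4] p5 by simp
    next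
      case False
      then have "p dvd p choose k" using k prime_p by (intro dvd_choose_prime) auto
      then have "of_nat (p choose k) \<in> \<P> 1" by (intro of_nat_ideal) simp
      from ideal_mult[OF this yk[of k]] show ?thesis
        by (rule ideal_mono) (use k in auto)
    qed
  qed
  finally show ?thesis .
qed

text \<open>Fermat gives \<open>A ^ (p - 1) = 1 + p * w\<close>, and expanding the
  \<open>p\<close>-th power turns \<open>H\<close> into
  \<open>w + p * c * w ^ 2 + 2 * h \<in> \<P> 2\<close> with \<open>c = (p - 1) / 2\<close>. Modulo
  \<open>p\<close>, \<open>w\<close> is \<open>- 2 * h\<close>; inserting this into the quadratic
  term determines \<open>w\<close> modulo \<open>p ^ 2\<close>.\<close>

lemma power_pred_from_quotient:
  assumes p: "p > 3" and A: "\<not> p dvd A" and h: "h \<in> Zp p"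
    and H: "of_nat A ^ (p * (p - 1)) - 1 + 2 * (of_nat p)\<^sup>2 * h \<in> \<P> 4"
  shows "of_nat A ^ (p - 1) - (1 - 2 * of_nat p * h + 2 * (of_nat p)\<^sup>2 * h\<^sup>2) \<in> \<P> 3"
proof -
  let ?p = "of_nat p :: rat"
  have "[A ^ (p - 1) = 1] (mod p ^ 1)"
    using fermat_theorem[OF prime_p A] by simp
  from ideal_of_nat_diff[OF this] obtain w where w: "w \<in> Zp p" "of_nat A ^ (p - 1) = 1 + ?p * w"
    by (auto simp: ideal_def algebra_simps)
  have pw: "?p * w \<in> \<P> 1" using ideal_p_power[OF w(1), of 1] by simp
  obtain c where pc: "p = 2 * c + 1" using odd_p by (rule oddE)
  then have c: "p - 1 = 2 * c" by simp
  have c': "2 * of_nat c = ?p - 1" using of_nat_pred unfolding c by simp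
  have "p choose 2 = p * c" using c by (simp add: choose_two)
  then have "(1 + ?p * w) ^ p - (1 + ?p * (?p * w) + ?p * of_nat c * (?p * w)\<^sup>2) \<in> \<P> 4"
    using one_plus_power_p[OF p pw] by simp
  moreover have "(1 + ?p * w) ^ p = of_nat A ^ (p * (p - 1))"
    unfolding w(2)[symmetric] by (simp add: power_mult[symmetric] mult.commute)
  ultimately have "?p\<^sup>2 * (w + ?p * of_nat c * w\<^sup>2 + 2 * h) \<in> \<P> (2 + 2)"
    using ideal_add[OF H, of "(1 + ?p * (?p * w) + ?p * of_nat c * (?p * w)\<^sup>2) - (1 + ?p * w) ^ p"]
    by (simp add: ideal_commute algebra_simps power2_eq_square)
  then have 1: "w + ?p * of_nat c * w\<^sup>2 + 2 * h \<in> \<P> 2" by (simp only: ideal_cancel)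
  have "?p * (of_nat c * w\<^sup>2) \<in> \<P> 1" using ideal_p_power[of "of_nat c * w\<^sup>2" 1] w by simp
  from ideal_diff[OF ideal_mono[OF 1] this] have "w + 2 * h \<in> \<P> 1" by (simp add: algebra_simps)
  then have "(w + 2 * h) * (w - 2 * h) \<in> \<P> 1" using w h by (intro ideal_mult_right) auto
  then have 2: "?p * ((w + 2 * h) * (w - 2 * h)) \<in> \<P> (Suc 1)" by (simp only: ideal_p_mult_iff)
  have 3: "?p ^ 2 * w\<^sup>2 \<in> \<P> 2" using w by (intro ideal_p_power) auto
  \<comment> \<open>Since \<open>2 * c = p - 1\<close>, doubling produces
    \<open>(p ^ 2 - p) * w ^ 2\<close>. The second term removes \<open>p ^ 2 * w ^ 2\<close>, and
    the third turns \<open>- p * w ^ 2\<close> into \<open>- 4 * p * h ^ 2\<close>.\<close>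
  have "2 * (w + ?p * of_nat c * w\<^sup>2 + 2 * h) - ?p ^ 2 * w\<^sup>2 + ?p * ((w + 2 * h) * (w - 2 * h)) \<in> \<P> 2"
    using 2 by (intro ideal_add[OF ideal_diff[OF ideal_mult_left[OF Zp_numeral 1] 3]]) (simp add: numeral_2_eq_2)
  also have "2 * (w + ?p * of_nat c * w\<^sup>2 + 2 * h) - ?p ^ 2 * w\<^sup>2 + ?p * ((w + 2 * h) * (w - 2 * h))
    = 2 * w + (2 * of_nat c) * ?p * w\<^sup>2 + 4 * h - ?p ^ 2 * w\<^sup>2 + ?p * ((w + 2 * h) * (w - 2 * h))"
    by (simp add: algebra_simps)
  also have "\<dots> = 2 * (w + 2 * h - 2 * ?p * h\<^sup>2)"
    unfolding c' by (simp add: algebra_simps power2_eq_square)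
  finally have "w + 2 * h - 2 * ?p * h\<^sup>2 \<in> \<P> 2" by (rule ideal_half)
  then have "?p * (w + 2 * h - 2 * ?p * h\<^sup>2) \<in> \<P> (Suc 2)" by (simp only: ideal_p_mult_iff)
  then show ?thesis unfolding w(2)
    by (simp add: algebra_simps power2_eq_square numeral_3_eq_3 flip: Suc_1)
qed

text \<open>From \<open>p ^ 2 = d * k + 1\<close> follows \<open>- 1 / d - k = - p ^ 2 / d\<close>,
  so \<open>T p (- 1 / d)\<close> is \<open>harm k\<close> modulo \<open>p ^ 2\<close>. Hence
  \<open>V\<close> and \<open>A ^ (p - 1)\<close> are congruent to the same quadratic expression,
  and multiplying by \<open>A ^ (p - 1)\<close> gives the square.\<close>

lemma V_power_congruence:
  assumes p: "p > 3" and d: "\<not> p dvd d" and N: "p\<^sup>2 = d * k + 1" and A: "\<not> p dvd A"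
    and H: "of_nat A ^ (p * (p - 1)) - 1 + 2 * (of_nat p)\<^sup>2 * harm k \<in> \<P> 4"
  shows "cong_Zp p 3 (of_nat A ^ (p - 1) * V (p - 1) (- 1 / of_nat d)) (of_nat (A\<^sup>2) ^ (p - 1))"
proof -
  define x :: rat where "x = - 1 / of_nat d"
  have x: "x \<in> Zp p" unfolding x_def using d by (intro Zp_divide_of_nat) auto
  have "d \<noteq> 0" using d by (metis dvd_0_right)
  have "of_nat p ^ 2 = (of_nat d * of_nat k + 1 :: rat)"
    using arg_cong[OF N, of "of_nat :: nat \<Rightarrow> rat"] by simp
  then have "x - of_nat k = of_nat p ^ 2 * x"
    using \<open>d \<noteq> 0\<close> by (simp add: x_def field_simps)
  then have "x - of_nat k \<in> \<P> 2" using x by (simp add: ideal_p_power)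
  from T_harm[OF x this] have Tk: "harm k - T p x \<in> \<P> 2" by (simp only: ideal_commute)
  have "\<not> exceptional p x" using p by (simp add: exceptional_def)
  from V_T_congruence[OF x this]
  have V: "V (p - 1) x - (1 - 2 * of_nat p * T p x + 2 * (of_nat p)\<^sup>2 * (T p x)\<^sup>2) \<in> \<P> 3"
    by (simp add: cong_Zp_iff)
  have "of_nat A ^ (p - 1) - (1 - 2 * of_nat p * T p x + 2 * (of_nat p)\<^sup>2 * (T p x)\<^sup>2) \<in> \<P> 3"
    using ideal_trans[OF power_pred_from_quotient[OF p A harm_Zp H] V_T_step[OF Tk harm_Zp T_Zp[OF x]]] .
  then have "(1 - 2 * of_nat p * T p x + 2 * (of_nat p)\<^sup>2 * (T p x)\<^sup>2) - of_nat A ^ (p - 1) \<in> \<P> 3"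
    by (simp only: ideal_commute)
  with V have "V (p - 1) x - of_nat A ^ (p - 1) \<in> \<P> 3" by (rule ideal_trans)
  then have "of_nat A ^ (p - 1) * (V (p - 1) x - of_nat A ^ (p - 1)) \<in> \<P> 3"
    by (intro ideal_mult_left) auto
  then have "of_nat A ^ (p - 1) * V (p - 1) x - of_nat (A\<^sup>2) ^ (p - 1) \<in> \<P> 3"
    by (simp add: algebra_simps power2_eq_square power_mult_distrib)
  then show ?thesis
    using V_Zp[OF x] by (auto simp: cong_Zp_iff x_def)
qed

section \<open>Euler quotients as logarithms modulo the fourth power of p\<close>

definition euler_diff :: "nat \<Rightarrow> rat" where
  "euler_diff d = of_nat d ^ (p * (p - 1)) - 1"

lemma euler_diff_ideal: "\<not> p dvd d \<Longrightarrow> euler_diff d \<in> \<P> 2"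
proof -
  assume "\<not> p dvd d"
  then have "coprime d (p\<^sup>2)"
    using prime_imp_coprime[OF prime_p] by (simp add: coprime_commute)
  from euler_theorem[OF this] have "[d ^ (p * (p - 1)) = 1] (mod p\<^sup>2)"
    using prime_p by (simp add: totient_prime_power)
  from ideal_of_nat_diff[OF this] show ?thesis by (simp add: euler_diff_def)
qed

text \<open>\<open>euler_diff (a * b)\<close> exceeds the sum of the two values by their product,
  and both of them lie in \<open>\<P> 2\<close>.\<close>

lemma euler_diff_mult:
  assumes "\<not> p dvd a" "\<not> p dvd b" "euler_diff a - u \<in> \<P> 4" "euler_diff b - v \<in> \<P> 4"
  shows "euler_diff (a * b) - (u + v) \<in> \<P> 4"
proof -
  have "euler_diff a * euler_diff b \<in> \<P> 4"
    using ideal_mult[OF euler_diff_ideal[OF assms(1)] euler_diff_ideal[OF assms(2)]] by simp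
  from ideal_add[OF this ideal_add[OF assms(3,4)]] show ?thesis
    by (simp add: euler_diff_def power_mult_distrib algebra_simps)
qed

lemma euler_diff_power:
  assumes "\<not> p dvd a"
  shows "euler_diff (a ^ n) - of_nat n * euler_diff a \<in> \<P> 4"
proof (induction n)
  case (Suc n)
  have "euler_diff (a * a ^ n) - (euler_diff a + of_nat n * euler_diff a) \<in> \<P> 4"
    by (intro euler_diff_mult assms not_dvd_power Suc.IH) simp
  then show ?case by (simp add: algebra_simps)
qed (simp add: euler_diff_def)

text \<open>This is \<open>fermat_quotient\<close> for \<open>r = 2\<close>: as
  \<open>i * p ^ 2 = i * k * d + i\<close> with \<open>i < d\<close>, the quotient by
  \<open>d\<close> is \<open>i * k\<close>.\<close>

lemma euler_diff_harm:
  assumes d: "\<not> p dvd d" and N: "p\<^sup>2 = d * k + 1"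
  shows "of_nat d * euler_diff d + (of_nat p)\<^sup>2 * (\<Sum>i=1..<d. harm (i * k)) \<in> \<P> 4"
proof -
  have "i * p\<^sup>2 div d = i * k" if "i \<in> {1..<d}" for i
  proof -
    have "i * p\<^sup>2 = i + (i * k) * d" by (simp add: N algebra_simps)
    then show ?thesis using that by (simp only: div_mult_self1) simp
  qed
  then have "(\<Sum>i=1..<d. harm (i * p\<^sup>2 div d)) = (\<Sum>i=1..<d. harm (i * k))"
    by (intro sum.cong refl) (simp only:)
  then show ?thesis
    using fermat_quotient[OF _ d, of 2] by (simp add: euler_diff_def)
qed

text \<open>Reflection modulo \<open>p ^ 2\<close> sends \<open>i * k\<close> to
  \<open>p ^ 2 - 1 - i * k = (d - i) * k\<close>.\<close>

lemma harm_reflect_multiple: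
  assumes N: "p\<^sup>2 = d * k + 1" and "i \<le> d"
  shows "of_nat p ^ 2 * (harm ((d - i) * k) - harm (i * k)) \<in> \<P> 4"
proof -
  have "i * k \<le> d * k" using assms(2) by simp
  then have "i * k < p\<^sup>2" unfolding N by linarith
  moreover have "p\<^sup>2 - 1 - i * k = (d - i) * k"
    unfolding N by (simp add: diff_mult_distrib)
  ultimately have "harm ((d - i) * k) - harm (i * k) \<in> \<P> 2"
    using harm_reflect[of 2 "i * k"] by simp
  then have "of_nat p ^ 2 * (harm ((d - i) * k) - harm (i * k)) \<in> \<P> (2 + 2)"
    by (simp only: ideal_cancel)
  then show ?thesis by simp
qed

lemma p_squared_mod_12:
  assumes "p > 3"
  shows "p\<^sup>2 mod 12 = 1"
proof -
  have "prime (3 :: nat)" by simp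
  then have "\<not> 3 dvd p"
    using primes_dvd_imp_eq[OF _ prime_p, of 3] assms by auto
  then have "p mod 12 = 1 \<or> p mod 12 = 5 \<or> p mod 12 = 7 \<or> p mod 12 = 11"
    using odd_p by presburger
  then have "(p mod 12)\<^sup>2 mod 12 = 1" by auto
  then show ?thesis by (simp add: power_mod)
qed

end

theorem theorem4p3:
  fixes p :: nat
  assumes "prime p" and "odd p"
  shows "(\<forall>x\<in>Zp p. \<not> exceptional p x \<longrightarrow>
            cong_Zp p 3 (V (p - 1) x) (1 - 2 * of_nat p * T p x + 2 * (of_nat p)\<^sup>2 * (T p x)\<^sup>2))
       \<and> (p > 3 \<longrightarrow>
            cong_Zp p 3 (V3 (p - 1)) (729 ^ (p - 1))
          \<and> cong_Zp p 3 (V4 (p - 1)) (4096 ^ (p - 1))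
          \<and> cong_Zp p 3 (V6 (p - 1)) (186624 ^ (p - 1)))"
proof -
  interpret odd_prime p by standard (rule assms)+
  have "cong_Zp p 3 (V3 (p - 1)) (729 ^ (p - 1)) \<and> cong_Zp p 3 (V4 (p - 1)) (4096 ^ (p - 1))
      \<and> cong_Zp p 3 (V6 (p - 1)) (186624 ^ (p - 1))" if p: "p > 3"
  proof -
    \<comment> \<open>12 is a common multiple of 2, 3, 4 and 6, so one \<open>k\<close> serves for
      all four: the quotients \<open>(p ^ 2 - 1) / d\<close> are \<open>6 * k\<close>,
      \<open>4 * k\<close>, \<open>3 * k\<close> and \<open>2 * k\<close>.\<close>
    obtain k where k: "p\<^sup>2 = 12 * k + 1"
      using p_squared_mod_12[OF p] by (metis div_mod_decomp mult.commute)
    have n2: "\<not> p dvd 2" and n3: "\<not> p dvd 3"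
      using p by (auto dest: dvd_imp_le)
    have dvd: "\<not> p dvd a * b" if "\<not> p dvd a" "\<not> p dvd b" for a b
      using that prime_p by (simp add: prime_dvd_mult_iff)
    have n4: "\<not> p dvd 4" and n6: "\<not> p dvd 6"
      using dvd[OF n2 n2] dvd[OF n2 n3] by simp_all
    let ?N = "(of_nat p)\<^sup>2 :: rat"
    have h2: "2 * euler_diff 2 + ?N * harm (6 * k) \<in> \<P> 4"
      using euler_diff_harm[OF n2, of "6 * k"] k by (simp add: numeral_2_eq_2)
    have "3 * euler_diff 3 + ?N * (harm (4 * k) + harm (2 * (4 * k))) \<in> \<P> 4"
      using euler_diff_harm[OF n3, of "4 * k"] k by (simp add: numeral_2_eq_2 numeral_3_eq_3)
    moreover have "?N * (harm (2 * (4 * k)) - harm (4 * k)) \<in> \<P> 4"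
      using harm_reflect_multiple[of 3 "4 * k" 1] k by simp
    ultimately have "3 * euler_diff 3 + ?N * (harm (4 * k) + harm (2 * (4 * k)))
       - ?N * (harm (2 * (4 * k)) - harm (4 * k)) \<in> \<P> 4" by (rule ideal_diff)
    then have h3: "3 * euler_diff 3 + 2 * ?N * harm (4 * k) \<in> \<P> 4" by (simp add: algebra_simps)
    have upt: "{1..<4} = {1, 2, 3 :: nat}" "{1..<6} = {1, 2, 3, 4, 5 :: nat}" by auto
    have "4 * euler_diff 4 + ?N * (harm (3 * k) + harm (6 * k) + harm (9 * k)) \<in> \<P> 4"
      using euler_diff_harm[OF n4, of "3 * k", unfolded upt] k by (simp add: add.assoc)
    moreover have "?N * (harm (9 * k) - harm (3 * k)) \<in> \<P> 4"
      using harm_reflect_multiple[of 4 "3 * k" 1] k by simp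
    ultimately have "4 * euler_diff 4 + ?N * (harm (3 * k) + harm (6 * k) + harm (9 * k))
       - ?N * (harm (9 * k) - harm (3 * k)) \<in> \<P> 4" by (rule ideal_diff)
    moreover have "euler_diff 4 - 2 * euler_diff 2 \<in> \<P> 4" using euler_diff_power[OF n2, of 2] by simp
    \<comment> \<open>Reflection of \<open>9 * k\<close>, the relation \<open>4 = 2 ^ 2\<close> and
      the case \<open>d = 2\<close> are subtracted in turn; of the harmonic sums only
      \<open>harm (3 * k)\<close> remains.\<close>
    ultimately have "4 * euler_diff 4 + ?N * (harm (3 * k) + harm (6 * k) + harm (9 * k))
       - ?N * (harm (9 * k) - harm (3 * k)) - 4 * (euler_diff 4 - 2 * euler_diff 2)
       - (2 * euler_diff 2 + ?N * harm (6 * k)) \<in> \<P> 4"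
      using h2 by (metis ideal_diff ideal_mult_left Zp_numeral)
    then have h4: "6 * euler_diff 2 + 2 * ?N * harm (3 * k) \<in> \<P> 4" by (simp add: algebra_simps)
    have "6 * euler_diff 6 + ?N * (harm (2 * k) + harm (4 * k) + harm (6 * k) + harm (8 * k) + harm (10 * k)) \<in> \<P> 4"
      using euler_diff_harm[OF n6, of "2 * k", unfolded upt] k by (simp add: add.assoc)
    moreover have "?N * (harm (10 * k) - harm (2 * k)) \<in> \<P> 4" "?N * (harm (8 * k) - harm (4 * k)) \<in> \<P> 4"
      using harm_reflect_multiple[of 6 "2 * k" 1] harm_reflect_multiple[of 6 "2 * k" 2] k by simp_all
    moreover have "euler_diff 6 - (euler_diff 2 + euler_diff 3) \<in> \<P> 4" using euler_diff_mult[OF n2 n3, of "euler_diff 2" "euler_diff 3"] by simp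
    \<comment> \<open>Reflection pairs \<open>10 * k\<close> with \<open>2 * k\<close> and
      \<open>8 * k\<close> with \<open>4 * k\<close>; then \<open>6 = 2 * 3\<close> and the cases
      \<open>d = 2\<close> and \<open>d = 3\<close> leave only \<open>harm (2 * k)\<close>.\<close>
    ultimately have "6 * euler_diff 6 + ?N * (harm (2 * k) + harm (4 * k) + harm (6 * k) + harm (8 * k) + harm (10 * k))
       - ?N * (harm (10 * k) - harm (2 * k)) - ?N * (harm (8 * k) - harm (4 * k)) - 6 * (euler_diff 6 - (euler_diff 2 + euler_diff 3))
       - (2 * euler_diff 2 + ?N * harm (6 * k)) - (3 * euler_diff 3 + 2 * ?N * harm (4 * k)) \<in> \<P> 4"
      using h2 h3 by (metis ideal_diff ideal_mult_left Zp_numeral)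
    then have h6: "4 * euler_diff 2 + 3 * euler_diff 3 + 2 * ?N * harm (2 * k) \<in> \<P> 4" by (simp add: algebra_simps)
    \<comment> \<open>The bases are chosen to match \<open>h3\<close>, \<open>h4\<close> and
      \<open>h6\<close>: \<open>27 = 3 ^ 3\<close>, \<open>64 = 2 ^ 6\<close> and
      \<open>432 = 2 ^ 4 * 3 ^ 3\<close>. Their squares are 729, 4096 and 186624.\<close>
    have q27: "euler_diff 27 - 3 * euler_diff 3 \<in> \<P> 4" and q64: "euler_diff 64 - 6 * euler_diff 2 \<in> \<P> 4"
      and q16: "euler_diff 16 - 4 * euler_diff 2 \<in> \<P> 4"
      using euler_diff_power[OF n3, of 3] euler_diff_power[OF n2, of 6] euler_diff_power[OF n2, of 4] by simp_all
    have n27: "\<not> p dvd 27" and n64: "\<not> p dvd 64" and n16: "\<not> p dvd 16"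
      using not_dvd_power[OF n3, of 3] not_dvd_power[OF n2, of 6] not_dvd_power[OF n2, of 4] by simp_all
    have n432: "\<not> p dvd 432" using dvd[OF n16 n27] by simp
    have q432: "euler_diff 432 - (4 * euler_diff 2 + 3 * euler_diff 3) \<in> \<P> 4" using euler_diff_mult[OF n16 n27 q16 q27] by simp
    have A: "of_nat A ^ (p * (p - 1)) - 1 + 2 * ?N * h \<in> \<P> 4"
      if "euler_diff A - u \<in> \<P> 4" "u + 2 * ?N * h \<in> \<P> 4" for A u h
      using ideal_add[OF that] by (simp add: euler_diff_def algebra_simps)
    have "cong_Zp p 3 (V3 (p - 1)) (729 ^ (p - 1))"
      using V_power_congruence[OF p n3 _ n27 A[OF q27 h3]] k by (simp add: V3_def)
    moreover have "cong_Zp p 3 (V4 (p - 1)) (4096 ^ (p - 1))"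
      using V_power_congruence[OF p n4 _ n64 A[OF q64 h4]] k by (simp add: V4_def)
    moreover have "cong_Zp p 3 (V6 (p - 1)) (186624 ^ (p - 1))"
      using V_power_congruence[OF p n6 _ n432 A[OF q432 h6]] k by (simp add: V6_def)
    ultimately show ?thesis by blast
  qed
  then show ?thesis using V_T_congruence by blast
qed

end
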